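(* Let $k\ge 7$ and let $G$ be a planar (finite simple) graph with maximum degree $\Delta\le k$. If $G$ contains neither a cycle of length 5 nor a cycle of length 6, then $\operatorname{col}(T(G))\le k+2$.
   Context: The total graph $T(G)$ has vertex set $V(G)\cup E(G)$, two elements adjacent iff they are adjacent or incident in $G$. The coloring number $\operatorname{col}(H)$ is the smallest integer $m$ such that some ordering of $V(H)$ has each vertex with at most $m-1$ neighbors among vertices of smaller index. *)

theory Defs
  imports "HOL-Analysis.Analysis"
begin

record 'a sgraph =
  verts :: "'a set"
  edges :: "'a set set"

definition finite_simple_graph :: "'a sgraph \<Rightarrow> bool" where
  "finite_simple_graph G \<longleftrightarrow>
     finite (verts G) \<and> (\<forall>e\<in>edges G. e \<subseteq> verts G \<and> card e = 2)"

definition degree :: "'a sgraph \<Rightarrow> 'a \<Rightarrow> nat" where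
  "degree G v = card {e \<in> edges G. v \<in> e}"

text \<open>Inserting 0 fixes the maximum degree of the graph without vertices to be 0.\<close>

definition max_degree :: "'a sgraph \<Rightarrow> nat" where
  "max_degree G = Max (insert 0 (degree G ` verts G))"

text \<open>Cycles are subgraphs, not necessarily induced ones.\<close>

definition has_cycle_of_length :: "'a sgraph \<Rightarrow> nat \<Rightarrow> bool" where
  "has_cycle_of_length G n \<longleftrightarrow>
     3 \<le> n \<and>
     (\<exists>c. length c = n \<and> distinct c \<and> set c \<subseteq> verts G \<and>
        (\<forall>i<n. {c ! i, c ! (Suc i mod n)} \<in> edges G))"

text \<open>
  A plane drawing: vertices are distinct points \<open>p v\<close>, every edge \<open>e\<close> is an injective
  continuous curve \<open>\<gamma> e\<close> between the points of its two end vertices that passes through no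
  other vertex, and two different edges meet at most in common end vertices.
\<close>

definition plane_drawing ::
    "'a sgraph \<Rightarrow> ('a \<Rightarrow> complex) \<Rightarrow> ('a set \<Rightarrow> real \<Rightarrow> complex) \<Rightarrow> bool" where
  "plane_drawing G p \<gamma> \<longleftrightarrow>
     inj_on p (verts G) \<and>
     (\<forall>e\<in>edges G. arc (\<gamma> e) \<and> {pathstart (\<gamma> e), pathfinish (\<gamma> e)} = p ` e \<and>
        path_image (\<gamma> e) \<inter> p ` verts G = p ` e) \<and>
     (\<forall>e\<in>edges G. \<forall>f\<in>edges G. e \<noteq> f \<longrightarrow>
        path_image (\<gamma> e) \<inter> path_image (\<gamma> f) \<subseteq> p ` (e \<inter> f))"

definition planar :: "'a sgraph \<Rightarrow> bool" where
  "planar G \<longleftrightarrow> (\<exists>p \<gamma>. plane_drawing G p \<gamma>)"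

definition total_graph :: "'a sgraph \<Rightarrow> ('a + 'a set) sgraph" where
  "total_graph G =
     \<lparr> verts = verts G <+> edges G,
       edges = {{Inl u, Inl v} | u v. {u, v} \<in> edges G}
             \<union> {{Inr e, Inr f} | e f. e \<in> edges G \<and> f \<in> edges G \<and> e \<noteq> f \<and> e \<inter> f \<noteq> {}}
             \<union> {{Inl v, Inr e} | v e. e \<in> edges G \<and> v \<in> e} \<rparr>"

text \<open>
  An ordering of the vertices is a list without repetitions. Over the natural numbers the bound
  ``at most \<open>m - 1\<close>'' has to be stated as \<open>< m\<close>, as subtraction is truncated. The \<open>LEAST\<close> is
  meaningful for finite graphs only.
\<close>

definition coloring_number :: "'b sgraph \<Rightarrow> nat" where
  "coloring_number H =
     (LEAST m. \<exists>vs. distinct vs \<and> set vs = verts H \<and>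
        (\<forall>i<length vs. card {j. j < i \<and> {vs ! j, vs ! i} \<in> edges H} < m))"

lemma finite_simple_graph_total_graph:
  assumes "finite_simple_graph G"
  shows "finite_simple_graph (total_graph G)"
proof -
  have fin: "finite (verts G)" and E: "\<And>e. e \<in> edges G \<Longrightarrow> e \<subseteq> verts G \<and> card e = 2"
    using assms by (auto simp: finite_simple_graph_def)
  have "edges G \<subseteq> Pow (verts G)" using E by auto
  then have fin_edges: "finite (edges G)" using fin by (meson finite_Pow_iff finite_subset)
  have "x \<subseteq> verts (total_graph G) \<and> card x = 2" if "x \<in> edges (total_graph G)" for x
  proof -
    from that consider
        (vv) u v where "x = {Inl u, Inl v}" "{u, v} \<in> edges G"
      | (ee) e f where "x = {Inr e, Inr f}" "e \<in> edges G" "f \<in> edges G" "e \<noteq> f"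
      | (ve) v e where "x = {Inl v, Inr e}" "e \<in> edges G" "v \<in> e"
      unfolding total_graph_def by auto
    then show ?thesis
    proof cases
      case vv
      have "u \<noteq> v" using E[OF vv(2)] by (cases "u = v") simp_all
      then show ?thesis using vv(1) E[OF vv(2)] by (simp add: total_graph_def InlI)
    next
      case ee
      then show ?thesis by (simp add: total_graph_def InrI)
    next
      case ve
      then show ?thesis using E[OF ve(2)] by (simp add: total_graph_def InlI InrI subset_iff)
    qed
  qed
  then show ?thesis
    using fin fin_edges by (simp add: finite_simple_graph_def total_graph_def)
qed

lemma coloring_number_ordering:
  assumes "finite (verts H)"
  shows "\<exists>vs. distinct vs \<and> set vs = verts H \<and>
    (\<forall>i<length vs. card {j. j < i \<and> {vs ! j, vs ! i} \<in> edges H} < coloring_number H)"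
proof -
  obtain vs where vs: "set vs = verts H" "distinct vs"
    using finite_distinct_list[OF assms] by blast
  have "card {j. j < i \<and> {vs ! j, vs ! i} \<in> edges H} < Suc (length vs)"
    if "i < length vs" for i
  proof -
    have "card {j. j < i \<and> {vs ! j, vs ! i} \<in> edges H} \<le> card {..<i}"
      by (rule card_mono) auto
    then show ?thesis using that by simp
  qed
  then have "distinct vs \<and> set vs = verts H \<and>
      (\<forall>i<length vs. card {j. j < i \<and> {vs ! j, vs ! i} \<in> edges H} < Suc (length vs))"
    using vs by simp
  then have "\<exists>m vs. distinct vs \<and> set vs = verts H \<and>
      (\<forall>i<length vs. card {j. j < i \<and> {vs ! j, vs ! i} \<in> edges H} < m)"
    by (intro exI)
  then show ?thesis
    unfolding coloring_number_def by (rule LeastI_ex)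
qed

end

theory Submission
  imports Defs "HOL-Complex_Analysis.Winding_Numbers"
begin

text \<open>
  Call an edge \<open>{u, v}\<close> light if \<open>2 d(u) \<le> k + 1\<close> and \<open>d(u) + d(v) \<le> k + 2\<close>. Given a good ordering for the
  total graph of \<open>G - {u, v}\<close>, move \<open>u\<close> to the end and put the edge \<open>{u, v}\<close> just before it: the edge
  then has at most \<open>d(u) + d(v) - 1\<close> earlier neighbours and \<open>u\<close> has \<open>2 d(u)\<close>. So it suffices that a
  graph with at least one edge has a light edge.

  Without light edges all degrees are at least 3, neighbours of 3-vertices have degree at least 7
  and neighbours of 4-vertices at least 6. In an end block with cut vertex \<open>x\<close> this holds for all
  vertices other than \<open>x\<close>, and all faces are cycles, of length 3, 4 or at least 7. Euler's formula gives
  \<open>4 |E| + 12 \<le> 6 |V| + 3 t + 2 q\<close>, where \<open>t\<close> and \<open>q\<close> count the triangular and quadrangular faces.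
  On the other hand let each vertex \<open>v\<close> give \<open>2 - 6 / d(v)\<close> to each of its edges (and \<open>x\<close> a little more, in
  total 10 units), and let each edge split what it got evenly among its small faces. As there are
  no 5-cycles, every triangle gets at least 3 and every quadrangle at least 2, hence
  \<open>3 t + 2 q \<le> 4 |E| - 6 |V| + 10\<close>, a contradiction.

  The faces of a 2-connected plane graph are built along an ear decomposition. Instead of the rotation
  at a vertex \<open>v\<close> only its consequence is recorded that a set of edges at \<open>v\<close> which meets each face
  boundary in an even number of edges is empty or contains all edges at \<open>v\<close>.
\<close>

section \<open>Theta curves\<close>

definition theta_curve :: "complex \<Rightarrow> complex \<Rightarrow> (real \<Rightarrow> complex) \<Rightarrow> (real \<Rightarrow> complex) \<Rightarrow> (real \<Rightarrow> complex) \<Rightarrow> bool" where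
  "theta_curve a b c1 c2 c \<longleftrightarrow> a \<noteq> b \<and>
     (\<forall>g\<in>{c1, c2, c}. arc g \<and> pathstart g = a \<and> pathfinish g = b) \<and>
     path_image c1 \<inter> path_image c2 = {a, b} \<and>
     path_image c1 \<inter> path_image c = {a, b} \<and>
     path_image c2 \<inter> path_image c = {a, b}"

lemma theta_curve_perm:
  assumes "theta_curve a b c1 c2 c"
  shows "theta_curve a b c1 c c2" "theta_curve a b c2 c1 c" "theta_curve a b c2 c c1"
  using assms unfolding theta_curve_def by (auto simp: Int_commute)

lemma theta_curve_arc_nonempty:
  assumes "theta_curve a b c1 c2 c"
  shows "path_image c - {a, b} \<noteq> {}"
proof -
  have "simple_path c" "pathstart c = a" "pathfinish c = b"
    using assms arc_imp_simple_path unfolding theta_curve_def by blast+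
  then show ?thesis using nonempty_simple_path_endless[of c] by simp
qed

lemma theta_curve_loop:
  assumes "theta_curve a b c1 c2 c"
  shows "simple_path (c1 +++ reversepath c2)"
    "pathfinish (c1 +++ reversepath c2) = pathstart (c1 +++ reversepath c2)"
    "path_image (c1 +++ reversepath c2) = path_image c1 \<union> path_image c2"
  using assms unfolding theta_curve_def
  by (auto intro!: simple_path_join_loop arc_reversepath simp: path_image_join)

text \<open>The known splitting theorem for a chord that enters the inside of a Jordan curve. Chords
  in the outside are reduced to it below by exchanging the roles of the arcs.\<close>

lemma theta_curve_split_inside:
  assumes "theta_curve a b c1 c2 c"
    and "path_image c \<inter> inside (path_image c1 \<union> path_image c2) \<noteq> {}"
  shows "inside (path_image c1 \<union> path_image c) \<inter> inside (path_image c2 \<union> path_image c) = {}"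
    and "inside (path_image c1 \<union> path_image c) \<union> inside (path_image c2 \<union> path_image c) \<union>
           (path_image c - {a, b}) = inside (path_image c1 \<union> path_image c2)"
proof -
  note th = assms(1)[unfolded theta_curve_def]
  have "inside (path_image c1 \<union> path_image c) \<inter> inside (path_image c2 \<union> path_image c) = {} \<and>
    inside (path_image c1 \<union> path_image c) \<union> inside (path_image c2 \<union> path_image c) \<union>
           (path_image c - {a, b}) = inside (path_image c1 \<union> path_image c2)"
    by (rule split_inside_simple_closed_curve[of c1 a b c2 c])
      (use th assms(2) in \<open>auto simp: arc_imp_simple_path\<close>)
  then show "inside (path_image c1 \<union> path_image c) \<inter> inside (path_image c2 \<union> path_image c) = {}"
    and "inside (path_image c1 \<union> path_image c) \<union> inside (path_image c2 \<union> path_image c) \<union>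
           (path_image c - {a, b}) = inside (path_image c1 \<union> path_image c2)" by auto
qed

text \<open>The closed curve \<open>c1 +++ reversepath c2\<close> has winding number 0 at outside
  points, and this number is the difference of those of the two arcs.\<close>

lemma winding_number_eq_if_outside:
  assumes "theta_curve a b c1 c2 c" "z \<in> outside (path_image c1 \<union> path_image c2)"
  shows "winding_number c1 z = winding_number c2 z"
proof -
  note th = assms(1)[unfolded theta_curve_def]
  have z: "z \<notin> path_image c1" "z \<notin> path_image c2"
    using assms(2) by (auto simp: outside_def)
  have "winding_number (c1 +++ reversepath c2) z = 0"
    using theta_curve_loop[OF assms(1)] assms(2)
    by (intro winding_number_zero_in_outside) (auto simp: simple_path_imp_path)
  moreover have "winding_number (c1 +++ reversepath c2) z = winding_number c1 z - winding_number c2 z"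
    using th z by (simp add: winding_number_join winding_number_reversepath arc_imp_path)
  ultimately show ?thesis by simp
qed

text \<open>The same difference now has absolute value 1, because the closed curve is
  simple.\<close>

lemma winding_number_neq_if_inside:
  assumes "theta_curve a b c1 c2 c" "z \<in> inside (path_image c1 \<union> path_image c2)"
  shows "winding_number c1 z \<noteq> winding_number c2 z"
proof -
  note th = assms(1)[unfolded theta_curve_def]
  have z: "z \<notin> path_image c1" "z \<notin> path_image c2"
    using assms(2) by (auto simp: inside_def)
  have "norm (winding_number (c1 +++ reversepath c2) z) = 1"
    using theta_curve_loop[OF assms(1)] assms(2)
    by (intro simple_closed_path_norm_winding_number_inside) auto
  moreover have "winding_number (c1 +++ reversepath c2) z = winding_number c1 z - winding_number c2 z"
    using th z by (simp add: winding_number_join winding_number_reversepath arc_imp_path)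
  ultimately show ?thesis by auto
qed

lemma connected_subset_inside:
  assumes "connected A" "A \<inter> S = {}" "A \<inter> inside S \<noteq> {}"
  shows "A \<subseteq> inside S"
proof
  fix y assume "y \<in> A"
  obtain x where x: "x \<in> A" "x \<in> inside S" using assms(3) by blast
  have "connected_component (- S) x y"
    unfolding connected_component_def using assms \<open>y \<in> A\<close> x by blast
  then show "y \<in> inside S" using x inside_same_component by blast
qed

lemma connected_subset_outside:
  assumes "connected A" "A \<inter> S = {}" "A \<inter> outside S \<noteq> {}"
  shows "A \<subseteq> outside S"
proof
  fix y assume "y \<in> A"
  obtain x where x: "x \<in> A" "x \<in> outside S" using assms(3) by blast
  have "connected_component (- S) x y"
    unfolding connected_component_def using assms \<open>y \<in> A\<close> x by blast
  then show "y \<in> outside S" using x outside_same_component by blast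
qed

text \<open>Each inside is connected and misses the boundary of the other one, so a common point
  puts each into the other. Equal insides have equal frontiers, and then \<open>c\<close> would
  consist of its two ends.\<close>

lemma theta_curve_not_in_two_insides:
  assumes "theta_curve a b c1 c2 c"
    and no: "path_image c \<inter> inside (path_image c1 \<union> path_image c2) = {}"
      "path_image c2 \<inter> inside (path_image c1 \<union> path_image c) = {}"
    and z: "z \<in> inside (path_image c1 \<union> path_image c2)" "z \<in> inside (path_image c1 \<union> path_image c)"
  shows False
proof -
  have th': "theta_curve a b c1 c c2" using theta_curve_perm[OF assms(1)] by simp
  let ?A = "inside (path_image c1 \<union> path_image c2)" and ?B = "inside (path_image c1 \<union> path_image c)"
  have J: "connected ?A" "frontier ?A = path_image c1 \<union> path_image c2"
    using Jordan_inside_outside[OF theta_curve_loop(1,2)[OF assms(1)]] theta_curve_loop(3)[OF assms(1)]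
    by simp_all
  have J': "connected ?B" "frontier ?B = path_image c1 \<union> path_image c"
    using Jordan_inside_outside[OF theta_curve_loop(1,2)[OF th']] theta_curve_loop(3)[OF th']
    by simp_all
  have no': "?A \<inter> (path_image c1 \<union> path_image c) = {}" "?B \<inter> (path_image c1 \<union> path_image c2) = {}"
    using no inside_no_overlap[of "path_image c1 \<union> path_image c2"]
      inside_no_overlap[of "path_image c1 \<union> path_image c"] by blast+
  have "?A \<subseteq> ?B" using J(1) no'(1) z
    by (intro connected_subset_inside) blast+
  moreover have "?B \<subseteq> ?A" using J'(1) no'(2) z
    by (intro connected_subset_inside) blast+
  ultimately have "?A = ?B" by (rule subset_antisym)
  then have "path_image c1 \<union> path_image c2 = path_image c1 \<union> path_image c"
    using J(2) J'(2) by metis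
  moreover have "path_image c1 \<inter> path_image c = {a, b}" "path_image c2 \<inter> path_image c = {a, b}"
    using assms(1) by (simp_all add: theta_curve_def)
  ultimately have "path_image c \<subseteq> {a, b}" by blast
  then show False using theta_curve_arc_nonempty[OF assms(1)] by blast
qed

text \<open>
  If no arc were inside the circle of the other two, then each of the three insides would be a component of
  the complement of the theta curve. Winding numbers add up, so a point of one inside lies in a second
  one; the two insides then coincide, which contradicts their different frontiers.
\<close>

lemma theta_curve_some_inside:
  assumes "theta_curve a b c1 c2 c"
  shows "path_image c \<inter> inside (path_image c1 \<union> path_image c2) \<noteq> {} \<or>
    path_image c1 \<inter> inside (path_image c2 \<union> path_image c) \<noteq> {} \<or>
    path_image c2 \<inter> inside (path_image c1 \<union> path_image c) \<noteq> {}"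
proof (rule ccontr)
  assume none: "\<not> ?thesis"
  note perm = theta_curve_perm[OF assms]
  obtain z where z: "z \<in> inside (path_image c1 \<union> path_image c2)"
    using Jordan_inside_outside[of "c1 +++ reversepath c2"] theta_curve_loop[OF assms] by auto
  have zc: "z \<notin> path_image c1" "z \<notin> path_image c2" "z \<notin> path_image c"
    using none z by (auto simp: inside_def)
  show False
  proof (cases "z \<in> inside (path_image c1 \<union> path_image c) \<or> z \<in> inside (path_image c2 \<union> path_image c)")
    case True
    then show False
      using theta_curve_not_in_two_insides[OF assms _ _ z] theta_curve_not_in_two_insides[OF perm(2), of z] none z
      by (auto simp: Un_commute)
  next
    case False
    then have "z \<in> outside (path_image c1 \<union> path_image c)" "z \<in> outside (path_image c2 \<union> path_image c)"
      using zc by (auto simp: outside_inside)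
    then show False
      using winding_number_eq_if_outside[OF perm(1)] winding_number_eq_if_outside[OF perm(3)]
        winding_number_neq_if_inside[OF assms z] by simp
  qed
qed

text \<open>As \<open>c2\<close> enters the inside of the circle formed by \<open>c1\<close> and
  \<open>c\<close>, it cuts this inside into the insides of the other two circles. Passing to
  complements gives the splitting of the outside.\<close>

lemma theta_curve_split_outside:
  assumes th: "theta_curve a b c1 c2 c"
    and "path_image c - {a, b} \<subseteq> outside (path_image c1 \<union> path_image c2)"
    and c2: "path_image c2 \<inter> inside (path_image c1 \<union> path_image c) \<noteq> {}"
  shows "outside (path_image c1 \<union> path_image c) \<inter> inside (path_image c2 \<union> path_image c) = {}"
    and "outside (path_image c1 \<union> path_image c) \<union> inside (path_image c2 \<union> path_image c) \<union>
           (path_image c - {a, b}) = outside (path_image c1 \<union> path_image c2)"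
proof -
  note s = theta_curve_split_inside[OF theta_curve_perm(1)[OF th] c2]
  have ab: "path_image c2 \<inter> path_image c = {a, b}" "path_image c1 \<inter> path_image c = {a, b}"
    "path_image c1 \<inter> path_image c2 = {a, b}"
    using th by (auto simp: theta_curve_def)
  let ?i12 = "inside (path_image c1 \<union> path_image c2)" and ?i1 = "inside (path_image c1 \<union> path_image c)"
    and ?i2 = "inside (path_image c2 \<union> path_image c)"
  have s': "?i12 \<inter> ?i2 = {}" "?i12 \<union> ?i2 \<union> (path_image c2 - {a, b}) = ?i1"
    using s by (simp_all add: Un_commute)
  have no: "?i12 \<inter> (path_image c1 \<union> path_image c2) = {}" "?i1 \<inter> (path_image c1 \<union> path_image c) = {}"
    "?i2 \<inter> (path_image c2 \<union> path_image c) = {}" by simp_all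
  show "outside (path_image c1 \<union> path_image c) \<inter> ?i2 = {}"
    using s' by (auto simp: outside_inside)
  show "outside (path_image c1 \<union> path_image c) \<union> ?i2 \<union>
           (path_image c - {a, b}) = outside (path_image c1 \<union> path_image c2)"
  proof (rule set_eqI)
    fix z
    \<comment> \<open>All set relations are turned into propositional facts about the single point
      \<open>z\<close>; the claim is then a propositional consequence.\<close>
    let ?e = "z \<in> {a, b}"
    have "z \<in> ?i1 \<longleftrightarrow> z \<in> ?i12 \<or> z \<in> ?i2 \<or> z \<in> path_image c2 \<and> \<not> ?e"
      "z \<notin> ?i12 \<or> z \<notin> ?i2"
      using s' by blast+
    moreover have "z \<in> path_image c2 \<and> z \<in> path_image c \<longleftrightarrow> ?e" "z \<in> path_image c1 \<and> z \<in> path_image c \<longleftrightarrow> ?e"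
      "z \<in> path_image c1 \<and> z \<in> path_image c2 \<longleftrightarrow> ?e"
      using ab by blast+
    moreover have "\<not> (z \<in> ?i12 \<and> (z \<in> path_image c1 \<or> z \<in> path_image c2))"
      "\<not> (z \<in> ?i1 \<and> (z \<in> path_image c1 \<or> z \<in> path_image c))"
      "\<not> (z \<in> ?i2 \<and> (z \<in> path_image c2 \<or> z \<in> path_image c))"
      using no by blast+
    moreover have "z \<in> path_image c \<and> \<not> ?e \<Longrightarrow> z \<notin> path_image c1 \<and> z \<notin> path_image c2 \<and> z \<notin> ?i12"
      using assms(2) unfolding outside_inside by blast
    ultimately show "z \<in> outside (path_image c1 \<union> path_image c) \<union> ?i2 \<union> (path_image c - {a, b}) \<longleftrightarrow>
        z \<in> outside (path_image c1 \<union> path_image c2)"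
      unfolding outside_inside Un_iff Compl_iff Diff_iff by argo
  qed
qed

text \<open>A chord in the outside creates one inside and one outside, and which is which depends on
  the arc that the chord encloses with the help of the other one; the statement leaves this
  open.\<close>

lemma theta_curve_split:
  assumes th: "theta_curve a b c1 c2 c"
    and R: "R \<in> {inside (path_image c1 \<union> path_image c2), outside (path_image c1 \<union> path_image c2)}"
    and c: "path_image c - {a, b} \<subseteq> R"
  obtains R1 R2 where
    "R1 \<in> {inside (path_image c1 \<union> path_image c), outside (path_image c1 \<union> path_image c)}"
    "R2 \<in> {inside (path_image c2 \<union> path_image c), outside (path_image c2 \<union> path_image c)}"
    "R1 \<inter> R2 = {}" "R1 \<union> R2 \<union> (path_image c - {a, b}) = R"
proof -
  note ne = theta_curve_arc_nonempty[OF th]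
  show thesis
  proof (cases "R = inside (path_image c1 \<union> path_image c2)")
    case True
    then show thesis using theta_curve_split_inside[OF th] ne c that by blast
  next
    case False
    then have R: "R = outside (path_image c1 \<union> path_image c2)" using R by simp
    have "a \<notin> inside (path_image c1 \<union> path_image c2)" "b \<notin> inside (path_image c1 \<union> path_image c2)"
      using th unfolding theta_curve_def inside_def by auto
    then have "path_image c \<inter> inside (path_image c1 \<union> path_image c2) = {}"
      using c unfolding R outside_inside by auto
    then consider "path_image c1 \<inter> inside (path_image c2 \<union> path_image c) \<noteq> {}"
      | "path_image c2 \<inter> inside (path_image c1 \<union> path_image c) \<noteq> {}"
      using theta_curve_some_inside[OF th] by blast
    then show thesis
    proof cases
      \<comment> \<open>Here \<open>c\<close> and \<open>c2\<close> enclose \<open>c1\<close>, so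
        the outer one of the new regions is bounded by \<open>c2\<close> and
        \<open>c\<close>.\<close>
      case 1
      have "path_image c - {a, b} \<subseteq> outside (path_image c2 \<union> path_image c1)"
        using c R by (simp add: Un_commute)
      note s = theta_curve_split_outside[OF theta_curve_perm(2)[OF th] this 1]
      show thesis
        by (rule that[of "inside (path_image c1 \<union> path_image c)" "outside (path_image c2 \<union> path_image c)"])
          (use s R in \<open>auto simp: Un_commute\<close>)
    next
      case 2
      note s = theta_curve_split_outside[OF th c[unfolded R] 2]
      show thesis
        by (rule that[of "outside (path_image c1 \<union> path_image c)" "inside (path_image c2 \<union> path_image c)"])
          (use s R in auto)
    qed
  qed
qed

section \<open>Paths and cycles as edge sets\<close>

fun path_edges :: "'a list \<Rightarrow> 'a set set" where
  "path_edges (x # y # zs) = insert {x, y} (path_edges (y # zs))"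
| "path_edges _ = {}"

text \<open>Cycles are edge sets, so that no starting vertex or direction has to be chosen. Length
  at least 3 rules out an edge traversed back and forth.\<close>

definition is_cycle :: "'a set set \<Rightarrow> bool" where
  "is_cycle F \<longleftrightarrow> (\<exists>c. distinct c \<and> 3 \<le> length c \<and> F = path_edges (c @ [hd c]))"

lemma path_edges_append:
  "path_edges (xs @ y # ys) = path_edges (xs @ [y]) \<union> path_edges (y # ys)"
proof (induction xs)
  case Nil
  then show ?case by simp
next
  case (Cons x xs)
  then show ?case by (cases xs) auto
qed

lemma path_edges_rev: "path_edges (rev xs) = path_edges xs"
proof (induction xs rule: path_edges.induct)
  case (1 x y zs)
  have "path_edges (rev (x # y # zs)) = path_edges (rev zs @ [y]) \<union> path_edges [y, x]"
    using path_edges_append[of "rev zs" y "[x]"] by simp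
  then show ?case using 1 by (auto simp: insert_commute)
qed auto

lemma path_edges_subset: "e \<in> path_edges xs \<Longrightarrow> e \<subseteq> set xs"
  by (induction xs rule: path_edges.induct) auto

lemma finite_path_edges [simp]: "finite (path_edges xs)"
  by (induction xs rule: path_edges.induct) auto

lemma Union_path_edges: "2 \<le> length xs \<Longrightarrow> \<Union>(path_edges xs) = set xs"
proof (induction xs rule: path_edges.induct)
  case (1 x y zs)
  then show ?case by (cases zs) auto
qed auto

lemma path_edges_conv_nth: "path_edges xs = {{xs ! i, xs ! Suc i} | i. Suc i < length xs}"
proof (induction xs rule: path_edges.induct)
  case (1 x y zs)
  show ?case
  proof (rule set_eqI)
    fix e
    have "e \<in> path_edges (x # y # zs) \<longleftrightarrow>
        e = {x, y} \<or> (\<exists>i. e = {(y # zs) ! i, (y # zs) ! Suc i} \<and> Suc i < length (y # zs))"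
      using 1 by auto
    also have "\<dots> \<longleftrightarrow> (\<exists>i. e = {(x # y # zs) ! i, (x # y # zs) ! Suc i} \<and> Suc i < length (x # y # zs))"
      (is "?l \<longleftrightarrow> (\<exists>i. ?P i)")
    proof
      assume ?l
      then show "\<exists>i. ?P i"
      proof
        assume "e = {x, y}"
        then have "?P 0" by simp
        then show ?thesis ..
      next
        assume "\<exists>i. e = {(y # zs) ! i, (y # zs) ! Suc i} \<and> Suc i < length (y # zs)"
        then obtain i where "e = {(y # zs) ! i, (y # zs) ! Suc i}" "Suc i < length (y # zs)" by blast
        then have "?P (Suc i)" by simp
        then show ?thesis ..
      qed
    next
      assume "\<exists>i. ?P i"
      then obtain i where i: "?P i" ..
      then show ?l by (cases i) auto
    qed
    finally show "e \<in> path_edges (x # y # zs) \<longleftrightarrow>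
        e \<in> {{(x # y # zs) ! i, (x # y # zs) ! Suc i} | i. Suc i < length (x # y # zs)}" by blast
  qed
qed auto

lemma card_path_edges: "distinct xs \<Longrightarrow> card (path_edges xs) = length xs - 1"
proof (induction xs rule: path_edges.induct)
  case (1 x y zs)
  have "{x, y} \<notin> path_edges (y # zs)"
    using path_edges_subset[of "{x, y}" "y # zs"] 1 by auto
  then show ?case using 1 by simp
qed auto

lemma star_path_edges_hd:
  "distinct (a # xs) \<Longrightarrow> xs \<noteq> [] \<Longrightarrow> {e \<in> path_edges (a # xs). a \<in> e} = {{a, hd xs}}"
  using path_edges_subset[of _ xs] by (cases xs) auto

lemma path_edges_card2: "distinct xs \<Longrightarrow> e \<in> path_edges xs \<Longrightarrow> card e = 2"
  by (induction xs rule: path_edges.induct) auto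

text \<open>The cycle runs along one path and back along the other. The second assumption excludes
  that both paths are the edge \<open>{a, b}\<close>.\<close>

lemma is_cycleI:
  assumes "distinct (a # xs @ b # ys)" "xs \<noteq> [] \<or> ys \<noteq> []"
  shows "is_cycle (path_edges (a # xs @ [b]) \<union> path_edges (a # ys @ [b]))"
proof -
  have "path_edges ((a # xs @ b # rev ys) @ [a]) = path_edges ((a # xs) @ [b]) \<union> path_edges (b # rev ys @ [a])"
    using path_edges_append[of "a # xs" b "rev ys @ [a]"] by simp
  also have "path_edges (b # rev ys @ [a]) = path_edges (a # ys @ [b])"
    using path_edges_rev[of "a # ys @ [b]"] by simp
  finally have eq: "path_edges (a # xs @ [b]) \<union> path_edges (a # ys @ [b]) =
      path_edges ((a # xs @ b # rev ys) @ [hd (a # xs @ b # rev ys)])" by simp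
  have "3 \<le> length (a # xs @ b # rev ys)" using assms(2) by (cases xs; cases ys) auto
  moreover have "distinct (a # xs @ b # rev ys)" using assms(1) by auto
  ultimately show ?thesis unfolding is_cycle_def using eq by blast
qed

lemma is_cycle_rotate:
  assumes "is_cycle F" "a \<in> \<Union>F"
  obtains xs where "distinct (a # xs)" "2 \<le> length xs" "F = path_edges (a # xs @ [a])"
proof -
  obtain c where c: "distinct c" "3 \<le> length c" "F = path_edges (c @ [hd c])"
    using assms(1) unfolding is_cycle_def by blast
  have "a \<in> set (c @ [hd c])" using assms(2) path_edges_subset unfolding c(3) by blast
  then have "a \<in> set c" using c(2) by (cases c) auto
  then obtain us vs where c': "c = us @ a # vs" by (auto simp: in_set_conv_decomp)
  have "F = path_edges (a # (vs @ us) @ [a])"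
  proof (cases us)
    case Nil
    then show ?thesis using c(3) c' by simp
  next
    case (Cons u us')
    then have "F = path_edges (us @ a # vs @ [u])" using c(3) c' by simp
    also have "\<dots> = path_edges (us @ [a]) \<union> path_edges (a # vs @ [u])"
      by (rule path_edges_append)
    also have "\<dots> = path_edges (a # vs @ us @ [a])"
      using path_edges_append[of "a # vs" u "us' @ [a]"] Cons by (simp add: Un_commute)
    finally show ?thesis by simp
  qed
  moreover have "distinct (a # (vs @ us))" "2 \<le> length (vs @ us)" using c(1,2) c' by auto
  ultimately show thesis using that by blast
qed

text \<open>Supplies two arcs of a theta curve: the cycle is started at \<open>a\<close> and cut at
  \<open>b\<close>, and the second part is reversed so that both paths run from \<open>a\<close> to
  \<open>b\<close>.\<close>

lemma is_cycle_split:
  assumes "is_cycle F" "a \<in> \<Union>F" "b \<in> \<Union>F" "a \<noteq> b"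
  obtains xs ys where "distinct (a # xs @ b # ys)" "xs \<noteq> [] \<or> ys \<noteq> []"
    "F = path_edges (a # xs @ [b]) \<union> path_edges (a # ys @ [b])"
    "path_edges (a # xs @ [b]) \<inter> path_edges (a # ys @ [b]) = {}"
    "\<Union>F = set (a # xs @ b # ys)"
proof -
  obtain zs where zs: "distinct (a # zs)" "2 \<le> length zs" "F = path_edges (a # zs @ [a])"
    by (rule is_cycle_rotate[OF assms(1,2)])
  have U: "\<Union>F = set (a # zs)" unfolding zs(3) by (subst Union_path_edges) auto
  then have "b \<in> set zs" using assms by auto
  then obtain xs ys where zs': "zs = xs @ b # ys" by (auto simp: in_set_conv_decomp)
  have F: "F = path_edges (a # xs @ [b]) \<union> path_edges (a # rev ys @ [b])"
    using zs(3) zs' path_edges_append[of "a # xs" b "ys @ [a]"] path_edges_rev[of "b # ys @ [a]"]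
    by simp
  have ne: "xs \<noteq> [] \<or> ys \<noteq> []" using zs(2) zs' by (cases xs; cases ys) auto
  have d: "distinct (a # xs @ b # ys)" using zs(1) zs' by auto
  \<comment> \<open>A common edge can only be \<open>{a, b}\<close>. As \<open>a\<close> has a
    single edge on each path, both paths would then consist of this edge alone.\<close>
  have "e \<notin> path_edges (a # rev ys @ [b])" if e: "e \<in> path_edges (a # xs @ [b])" for e
  proof
    assume e': "e \<in> path_edges (a # rev ys @ [b])"
    have "e \<subseteq> {a, b}" using path_edges_subset[OF e] path_edges_subset[OF e'] d by auto
    moreover have "card e = 2" using path_edges_card2[OF _ e] d by auto
    ultimately have "e = {a, b}" using assms(4) by (simp add: card_subset_eq)
    have snoc_ne: "us @ [b] \<noteq> []" for us by simp
    have d': "distinct (a # rev ys @ [b])" "distinct (a # xs @ [b])" using d by auto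
    have "{a, b} \<in> {f \<in> path_edges (a # rev ys @ [b]). a \<in> f}" "{a, b} \<in> {f \<in> path_edges (a # xs @ [b]). a \<in> f}"
      using e e' \<open>e = {a, b}\<close> by auto
    then have "b = hd (rev ys @ [b])" "b = hd (xs @ [b])"
      unfolding star_path_edges_hd[OF d'(1) snoc_ne] star_path_edges_hd[OF d'(2) snoc_ne]
      by (simp_all only: singleton_iff doubleton_eq_iff) (use assms(4) in metis)+
    moreover have "b \<notin> set xs" "b \<notin> set (rev ys)" using d by auto
    ultimately have "xs = []" "rev ys = []" by (metis hd_append2 hd_in_set)+
    then show False using ne by simp
  qed
  then show thesis using that[of xs "rev ys"] F ne d U zs' by auto
qed

lemma is_cycle_star:
  assumes "is_cycle F" "a \<in> \<Union>F"
  obtains b c where "b \<noteq> c" "a \<noteq> b" "a \<noteq> c" "{e \<in> F. a \<in> e} = {{a, b}, {a, c}}"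
proof -
  obtain xs where xs: "distinct (a # xs)" "2 \<le> length xs" "F = path_edges (a # xs @ [a])"
    by (rule is_cycle_rotate[OF assms])
  obtain b c ys where ys: "xs = b # ys @ [c]"
  proof -
    obtain b zs where "xs = b # zs" "zs \<noteq> []" using xs(2) by (cases xs rule: path_edges.cases) auto
    then show thesis using that[of b "butlast zs" "last zs"] by simp
  qed
  have "F = path_edges (a # b # ys @ [c]) \<union> path_edges [c, a]"
    using xs(3) path_edges_append[of "a # b # ys" c "[a]"] ys by simp
  moreover have "{e \<in> path_edges (a # b # ys @ [c]). a \<in> e} = {{a, b}}"
    using star_path_edges_hd[of a "b # ys @ [c]"] xs(1) ys by simp
  ultimately have "{e \<in> F. a \<in> e} = {{a, b}, {a, c}}" by (auto simp: insert_commute)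
  then show thesis using that[of b c] xs(1) ys by auto
qed

lemma is_cycle_card_star:
  assumes "is_cycle F" "a \<in> \<Union>F"
  shows "card {e \<in> F. a \<in> e} = 2"
proof -
  obtain b c where "b \<noteq> c" "a \<noteq> b" "a \<noteq> c" "{e \<in> F. a \<in> e} = {{a, b}, {a, c}}"
    by (rule is_cycle_star[OF assms])
  moreover from this have "{a, b} \<noteq> {a, c}" by (auto simp: doubleton_eq_iff)
  ultimately show ?thesis by simp
qed

lemma is_cycle_card:
  assumes "is_cycle F"
  shows "card F = card (\<Union>F)" "3 \<le> card F" "finite F" "F \<noteq> {}"
proof -
  obtain c where c: "distinct c" "3 \<le> length c" "F = path_edges (c @ [hd c])"
    using assms unfolding is_cycle_def by blast
  then obtain a x zs where c': "c = a # x # zs" "zs \<noteq> []"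
    by (cases c rule: path_edges.cases) (auto simp: Suc_le_length_iff)
  obtain ws b where zs: "zs = ws @ [b]" using c'(2) by (cases zs rule: rev_exhaust) auto
  have "F = path_edges ((a # x # ws) @ b # [a])" using c c' zs by simp
  also have "\<dots> = path_edges c \<union> {{b, a}}"
    by (subst path_edges_append) (use zs c' in simp)
  finally have F: "F = insert {a, b} (path_edges c)" by (auto simp: insert_commute)
  have star: "{e \<in> path_edges c. a \<in> e} = {{a, x}}"
    using star_path_edges_hd[of a "x # zs"] c(1) c'(1) by simp
  \<comment> \<open>As the cycle has length at least 3, the closing edge differs from the only path
    edge at \<open>a\<close>, so it adds one to the number of edges.\<close>
  have ne: "{a, b} \<noteq> {a, x}" using c(1) c' zs by (auto simp: doubleton_eq_iff)
  have "{a, b} \<notin> path_edges c"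
  proof
    assume "{a, b} \<in> path_edges c"
    then have "{a, b} \<in> {e \<in> path_edges c. a \<in> e}" by simp
    then show False using ne unfolding star by simp
  qed
  then have card: "card F = length c" using F card_path_edges[OF c(1)] c(2) by simp
  have "\<Union>F = set c" unfolding c(3) using c' by (subst Union_path_edges) auto
  then show "card F = card (\<Union>F)" using card distinct_card[OF c(1)] by simp
  show "3 \<le> card F" using card c(2) by simp
  show "finite F" "F \<noteq> {}" using F by auto
qed

text \<open>Shows later that an ear whose inner vertices are new has only new edges.\<close>

lemma path_edges_meets_inner:
  assumes "zs \<noteq> []" "e \<in> path_edges (a # zs @ [b])"
  shows "e \<inter> set zs \<noteq> {}"
proof -
  have "\<And>e. e \<in> path_edges (zs @ [b]) \<Longrightarrow> e \<inter> set zs \<noteq> {}"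
    using assms(1)
  proof (induction zs)
    case (Cons x zs)
    then show ?case by (cases zs) auto
  qed simp
  then show ?thesis using assms by (cases zs) auto
qed

section \<open>Plane graphs\<close>

text \<open>The drawing conditions for a set of edges. Vertices are the elements of
  \<open>\<Union>E\<close>, so isolated vertices disappear and the locale can be instantiated for a
  single block.\<close>

locale plane_graph =
  fixes E :: "'a set set" and p :: "'a \<Rightarrow> complex" and \<gamma> :: "'a set \<Rightarrow> real \<Rightarrow> complex"
  assumes finite_E: "finite E"
    and card_edge: "e \<in> E \<Longrightarrow> card e = 2"
    and inj_p: "inj_on p (\<Union>E)"
    and arc_edge: "e \<in> E \<Longrightarrow> arc (\<gamma> e)"
    and edge_ends: "e \<in> E \<Longrightarrow> {pathstart (\<gamma> e), pathfinish (\<gamma> e)} = p ` e"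
    and edge_avoids: "e \<in> E \<Longrightarrow> path_image (\<gamma> e) \<inter> p ` \<Union>E = p ` e"
    and edges_cross: "e \<in> E \<Longrightarrow> f \<in> E \<Longrightarrow> e \<noteq> f \<Longrightarrow>
      path_image (\<gamma> e) \<inter> path_image (\<gamma> f) \<subseteq> p ` (e \<inter> f)"
begin

definition curve :: "'a set set \<Rightarrow> complex set" where
  "curve F = (\<Union>e\<in>F. path_image (\<gamma> e))"

text \<open>Both Jordan domains of a cycle are treated alike, since \<open>theta_curve_split\<close>
  may produce either of them.\<close>

definition sides :: "'a set set \<Rightarrow> complex set set" where
  "sides F = {inside (curve F), outside (curve F)}"

lemma curve_Un: "curve (A \<union> B) = curve A \<union> curve B"
  by (simp add: curve_def)

lemma curve_mono: "A \<subseteq> B \<Longrightarrow> curve A \<subseteq> curve B"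
  by (auto simp: curve_def)

lemma curve_Int:
  assumes "A \<subseteq> E" "B \<subseteq> E" "A \<inter> B = {}"
  shows "curve A \<inter> curve B \<subseteq> p ` (\<Union>A \<inter> \<Union>B)"
proof
  fix z assume "z \<in> curve A \<inter> curve B"
  then obtain e f where ef: "e \<in> A" "f \<in> B" "z \<in> path_image (\<gamma> e) \<inter> path_image (\<gamma> f)"
    by (auto simp: curve_def)
  then have "e \<noteq> f" "e \<in> E" "f \<in> E" using assms by auto
  then have "z \<in> p ` (e \<inter> f)" using edges_cross ef(3) by blast
  then show "z \<in> p ` (\<Union>A \<inter> \<Union>B)" using ef(1,2) by blast
qed

lemma vertex_on_curve_iff:
  assumes "F \<subseteq> E" "v \<in> \<Union>E"
  shows "p v \<in> curve F \<longleftrightarrow> v \<in> \<Union>F"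
proof
  assume "p v \<in> curve F"
  then obtain e where e: "e \<in> F" "p v \<in> path_image (\<gamma> e)" by (auto simp: curve_def)
  then have "p v \<in> p ` e" using edge_avoids[of e] assms by blast
  moreover have "e \<subseteq> \<Union>E" using e assms by blast
  ultimately have "v \<in> e" using inj_p assms(2) by (meson inj_on_image_mem_iff)
  then show "v \<in> \<Union>F" using e by blast
next
  assume "v \<in> \<Union>F"
  then obtain e where e: "e \<in> F" "v \<in> e" by blast
  then have "p v \<in> path_image (\<gamma> e)" using edge_avoids[of e] assms by blast
  then show "p v \<in> curve F" using e by (auto simp: curve_def)
qed

text \<open>The drawing fixes the ends of an edge curve only as an unordered pair; reversing the
  curve gives the required direction.\<close>

lemma arc_doubleton:
  assumes "{x, y} \<in> E"
  shows "\<exists>g. arc g \<and> path_image g = path_image (\<gamma> {x, y}) \<and> pathstart g = p x \<and> pathfinish g = p y"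
proof -
  have a: "arc (\<gamma> {x, y})" using arc_edge assms by blast
  have "{pathstart (\<gamma> {x, y}), pathfinish (\<gamma> {x, y})} = {p x, p y}"
    using edge_ends[OF assms] by simp
  then consider "pathstart (\<gamma> {x, y}) = p x" "pathfinish (\<gamma> {x, y}) = p y"
    | "pathstart (\<gamma> {x, y}) = p y" "pathfinish (\<gamma> {x, y}) = p x"
    by (auto simp: doubleton_eq_iff)
  then show ?thesis
  proof cases
    case 1
    then show ?thesis using a by blast
  next
    case 2
    have "arc (reversepath (\<gamma> {x, y}))" using a by (rule arc_reversepath)
    moreover have "path_image (reversepath (\<gamma> {x, y})) = path_image (\<gamma> {x, y})"
      "pathstart (reversepath (\<gamma> {x, y})) = p x" "pathfinish (reversepath (\<gamma> {x, y})) = p y"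
      using 2 by simp_all
    ultimately show ?thesis by blast
  qed
qed

lemma path_arc:
  assumes "distinct xs" "2 \<le> length xs" "path_edges xs \<subseteq> E"
  shows "\<exists>g. arc g \<and> path_image g = curve (path_edges xs) \<and> pathstart g = p (hd xs) \<and> pathfinish g = p (last xs)"
  using assms
proof (induction xs rule: path_edges.induct)
  case (1 x y zs)
  have "{x, y} \<in> E" using 1(4) by simp
  then obtain g1 where g1: "arc g1" "path_image g1 = curve {{x, y}}" "pathstart g1 = p x" "pathfinish g1 = p y"
    using arc_doubleton unfolding curve_def by fastforce
  show ?case
  proof (cases zs)
    case Nil
    then show ?thesis using g1 by auto
  next
    case (Cons z zs')
    have sub: "path_edges (y # zs) \<subseteq> E" using 1(4) by simp
    obtain g2 where g2: "arc g2" "path_image g2 = curve (path_edges (y # zs))"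
      "pathstart g2 = p y" "pathfinish g2 = p (last (y # zs))"
      using 1(1)[OF _ _ sub] 1(2) Cons by auto
    have U: "\<Union>(path_edges (y # zs)) = set (y # zs)" using Cons by (subst Union_path_edges) auto
    have "{x, y} \<notin> path_edges (y # zs)"
      using path_edges_subset[of "{x, y}" "y # zs"] 1(2) by auto
    then have "curve {{x, y}} \<inter> curve (path_edges (y # zs)) \<subseteq> p ` ({x, y} \<inter> set (y # zs))"
      using curve_Int[of "{{x, y}}" "path_edges (y # zs)"] \<open>{x, y} \<in> E\<close> sub U by simp
    also have "{x, y} \<inter> set (y # zs) = {y}" using 1(2) by auto
    finally have "arc (g1 +++ g2)" using g1 g2 by (intro arc_join) auto
    moreover have "path_image (g1 +++ g2) = curve (path_edges (x # y # zs))"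
      using g1 g2 curve_Un[of "{{x, y}}" "path_edges (y # zs)"] by (simp add: path_image_join)
    ultimately show ?thesis using g1 g2 Cons by (intro exI[of _ "g1 +++ g2"]) simp
  qed
qed auto

lemma path_arcs_Int:
  assumes "distinct (a # xs @ b # ys)"
    and "path_edges (a # xs @ [b]) \<subseteq> E" "path_edges (a # ys @ [b]) \<subseteq> E"
    and "path_edges (a # xs @ [b]) \<inter> path_edges (a # ys @ [b]) = {}"
  shows "curve (path_edges (a # xs @ [b])) \<inter> curve (path_edges (a # ys @ [b])) = {p a, p b}"
proof -
  have U: "\<Union>(path_edges (a # us @ [b])) = insert a (insert b (set us))" for us
    by (subst Union_path_edges) auto
  have "insert a (insert b (set xs)) \<inter> insert a (insert b (set ys)) = {a, b}" using assms(1) by auto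
  then have "curve (path_edges (a # xs @ [b])) \<inter> curve (path_edges (a # ys @ [b])) \<subseteq> p ` {a, b}"
    using curve_Int[OF assms(2-4)] unfolding U by metis
  moreover have "p a \<in> curve (path_edges (a # us @ [b]))" "p b \<in> curve (path_edges (a # us @ [b]))"
    if "path_edges (a # us @ [b]) \<subseteq> E" for us
  proof -
    have "a \<in> \<Union>(path_edges (a # us @ [b]))" "b \<in> \<Union>(path_edges (a # us @ [b]))" using U by auto
    moreover from this have "a \<in> \<Union>E" "b \<in> \<Union>E" using that by blast+
    ultimately show "p a \<in> curve (path_edges (a # us @ [b]))" "p b \<in> curve (path_edges (a # us @ [b]))"
      using vertex_on_curve_iff[OF that] by auto
  qed
  ultimately show ?thesis using assms(2,3) by auto
qed

text \<open>Two vertices cut the cycle into two arcs that meet only in their ends; one followed by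
  the reverse of the other is a simple closed path. This makes the Jordan curve theorem
  applicable.\<close>

lemma cycle_curve:
  assumes "is_cycle F" "F \<subseteq> E"
  obtains g where "simple_path g" "pathfinish g = pathstart g" "path_image g = curve F"
proof -
  obtain a where a: "a \<in> \<Union>F"
  proof -
    obtain e where "e \<in> F" using is_cycle_card(4)[OF assms(1)] by blast
    moreover have "e \<noteq> {}" using card_edge[of e] \<open>e \<in> F\<close> assms(2) by auto
    ultimately show thesis using that by blast
  qed
  obtain b where b: "b \<in> \<Union>F" "a \<noteq> b"
  proof -
    have "\<not> \<Union>F \<subseteq> {a}"
      using is_cycle_card(1,2)[OF assms(1)] card_mono[of "{a}" "\<Union>F"] by auto
    then show thesis using that by blast
  qed
  obtain xs ys where s: "distinct (a # xs @ b # ys)" "xs \<noteq> [] \<or> ys \<noteq> []"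
    "F = path_edges (a # xs @ [b]) \<union> path_edges (a # ys @ [b])"
    "path_edges (a # xs @ [b]) \<inter> path_edges (a # ys @ [b]) = {}"
    by (rule is_cycle_split[OF assms(1) a b])
  have sub: "path_edges (a # xs @ [b]) \<subseteq> E" "path_edges (a # ys @ [b]) \<subseteq> E"
    using s(3) assms(2) by auto
  obtain g1 where g1: "arc g1" "path_image g1 = curve (path_edges (a # xs @ [b]))" "pathstart g1 = p a" "pathfinish g1 = p b"
    using path_arc[OF _ _ sub(1)] s(1) by auto
  obtain g2 where g2: "arc g2" "path_image g2 = curve (path_edges (a # ys @ [b]))" "pathstart g2 = p a" "pathfinish g2 = p b"
    using path_arc[OF _ _ sub(2)] s(1) by auto
  have "simple_path (g1 +++ reversepath g2)"
    using g1 g2 path_arcs_Int[OF s(1) sub s(4)] by (intro simple_path_join_loop arc_reversepath) auto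
  moreover have "path_image (g1 +++ reversepath g2) = curve F"
    using g1 g2 s(3) curve_Un by (simp add: path_image_join)
  ultimately show thesis using that g1 g2 by simp
qed

lemma paths_theta_curve:
  assumes "distinct (a # xs @ b # ys)" "set zs \<inter> set (a # xs @ b # ys) = {}" "distinct zs"
    and sub: "path_edges (a # xs @ [b]) \<subseteq> E" "path_edges (a # ys @ [b]) \<subseteq> E" "path_edges (a # zs @ [b]) \<subseteq> E"
    and dis: "path_edges (a # xs @ [b]) \<inter> path_edges (a # ys @ [b]) = {}"
      "path_edges (a # xs @ [b]) \<inter> path_edges (a # zs @ [b]) = {}"
      "path_edges (a # ys @ [b]) \<inter> path_edges (a # zs @ [b]) = {}"
  obtains c1 c2 c where "theta_curve (p a) (p b) c1 c2 c" "path_image c1 = curve (path_edges (a # xs @ [b]))"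
     "path_image c2 = curve (path_edges (a # ys @ [b]))" "path_image c = curve (path_edges (a # zs @ [b]))"
proof -
  obtain g1 where g1: "arc g1" "path_image g1 = curve (path_edges (a # xs @ [b]))" "pathstart g1 = p a" "pathfinish g1 = p b"
    using path_arc[OF _ _ sub(1)] assms(1) by auto
  obtain g2 where g2: "arc g2" "path_image g2 = curve (path_edges (a # ys @ [b]))" "pathstart g2 = p a" "pathfinish g2 = p b"
    using path_arc[OF _ _ sub(2)] assms(1) by auto
  obtain g where g: "arc g" "path_image g = curve (path_edges (a # zs @ [b]))" "pathstart g = p a" "pathfinish g = p b"
    using path_arc[OF _ _ sub(3)] assms(1-3) by auto
  have "p a \<noteq> p b" using arc_distinct_ends[OF g1(1)] g1 by simp
  moreover have "path_image g1 \<inter> path_image g2 = {p a, p b}"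
    using path_arcs_Int[OF _ sub(1,2) dis(1)] assms(1) g1 g2 by simp
  moreover have "path_image g1 \<inter> path_image g = {p a, p b}"
    using path_arcs_Int[OF _ sub(1,3) dis(2)] assms(1-3) g1 g by auto
  moreover have "path_image g2 \<inter> path_image g = {p a, p b}"
    using path_arcs_Int[OF _ sub(2,3) dis(3)] assms(1-3) g2 g by auto
  ultimately have "theta_curve (p a) (p b) g1 g2 g" unfolding theta_curve_def using g1 g2 g by auto
  then show thesis using that g1 g2 g by blast
qed

end

text \<open>The open arc is the image of the open unit interval, so continuity puts the ends into
  its closure. This later places the ends of an ear on the boundary of the face around it.\<close>

lemma closure_arc_endless:
  assumes "arc g"
  shows "pathstart g \<in> closure (path_image g - {pathstart g, pathfinish g})"
    "pathfinish g \<in> closure (path_image g - {pathstart g, pathfinish g})"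
proof -
  let ?S = "path_image g - {pathstart g, pathfinish g}"
  have eq: "?S = g ` {0<..<1}" using simple_path_endless[OF arc_imp_simple_path[OF assms]] .
  have "continuous_on (closure {0<..<1}) g"
    using arc_imp_path[OF assms] by (simp add: path_def closure_greaterThanLessThan)
  then have "g ` closure {0<..<1} \<subseteq> closure (g ` {0<..<1})"
    by (rule image_closure_subset) (auto intro: closure_subset[THEN subsetD])
  then have "g ` {0..1} \<subseteq> closure ?S" unfolding eq by (simp add: closure_greaterThanLessThan)
  then show "pathstart g \<in> closure ?S" "pathfinish g \<in> closure ?S"
    by (auto simp: pathstart_def pathfinish_def)
qed

section \<open>Construction of the faces ear by ear\<close>

context plane_graph
begin

text \<open>
  Faces are pairs of a boundary cycle and an open region, as the two faces of a single cycle have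
  the same boundary.
\<close>

definition face_family :: "'a set set \<Rightarrow> ('a set set \<times> complex set) set \<Rightarrow> bool" where
  "face_family K \<Phi> \<longleftrightarrow> K \<subseteq> E \<and> finite \<Phi> \<and> card K + 2 = card \<Phi> + card (\<Union>K) \<and>
     (\<forall>(F, R)\<in>\<Phi>. F \<subseteq> K \<and> is_cycle F \<and> R \<in> sides F \<and> R \<inter> curve K = {}) \<and>
     (\<forall>\<phi>\<in>\<Phi>. \<forall>\<psi>\<in>\<Phi>. \<phi> \<noteq> \<psi> \<longrightarrow> snd \<phi> \<inter> snd \<psi> = {}) \<and>
     - curve K \<subseteq> \<Union>(snd ` \<Phi>) \<and>
     (\<forall>e\<in>K. card {\<phi> \<in> \<Phi>. e \<in> fst \<phi>} = 2) \<and>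
     (\<forall>v\<in>\<Union>K. \<forall>S\<subseteq>{e \<in> K. v \<in> e}. (\<forall>\<phi>\<in>\<Phi>. even (card (S \<inter> fst \<phi>))) \<longrightarrow> S = {} \<or> S = {e \<in> K. v \<in> e})"

lemma face_familyD:
  assumes "face_family K \<Phi>"
  shows "K \<subseteq> E" "finite \<Phi>" "card K + 2 = card \<Phi> + card (\<Union>K)"
    "(F, R) \<in> \<Phi> \<Longrightarrow> F \<subseteq> K" "(F, R) \<in> \<Phi> \<Longrightarrow> is_cycle F"
    "(F, R) \<in> \<Phi> \<Longrightarrow> R \<in> sides F" "(F, R) \<in> \<Phi> \<Longrightarrow> R \<inter> curve K = {}"
    "\<phi> \<in> \<Phi> \<Longrightarrow> \<psi> \<in> \<Phi> \<Longrightarrow> \<phi> \<noteq> \<psi> \<Longrightarrow> snd \<phi> \<inter> snd \<psi> = {}"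
    "z \<notin> curve K \<Longrightarrow> \<exists>(F, R)\<in>\<Phi>. z \<in> R"
    "e \<in> K \<Longrightarrow> card {\<phi> \<in> \<Phi>. e \<in> fst \<phi>} = 2"
    "v \<in> \<Union>K \<Longrightarrow> S \<subseteq> {e \<in> K. v \<in> e} \<Longrightarrow> (\<And>\<phi>. \<phi> \<in> \<Phi> \<Longrightarrow> even (card (S \<inter> fst \<phi>))) \<Longrightarrow>
       S = {} \<or> S = {e \<in> K. v \<in> e}"
proof -
  note ff = assms[unfolded face_family_def]
  show "K \<subseteq> E" "finite \<Phi>" "card K + 2 = card \<Phi> + card (\<Union>K)"
    "(F, R) \<in> \<Phi> \<Longrightarrow> F \<subseteq> K" "(F, R) \<in> \<Phi> \<Longrightarrow> is_cycle F"
    "(F, R) \<in> \<Phi> \<Longrightarrow> R \<in> sides F" "(F, R) \<in> \<Phi> \<Longrightarrow> R \<inter> curve K = {}"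
    "e \<in> K \<Longrightarrow> card {\<phi> \<in> \<Phi>. e \<in> fst \<phi>} = 2"
    using ff by (simp_all add: case_prod_unfold, (metis fst_conv snd_conv)+)
  have "- curve K \<subseteq> \<Union>(snd ` \<Phi>)" using ff by simp
  then show "z \<notin> curve K \<Longrightarrow> \<exists>(F, R)\<in>\<Phi>. z \<in> R" by fastforce
  have "\<forall>\<phi>\<in>\<Phi>. \<forall>\<psi>\<in>\<Phi>. \<phi> \<noteq> \<psi> \<longrightarrow> snd \<phi> \<inter> snd \<psi> = {}" using ff by simp
  then show "\<phi> \<in> \<Phi> \<Longrightarrow> \<psi> \<in> \<Phi> \<Longrightarrow> \<phi> \<noteq> \<psi> \<Longrightarrow> snd \<phi> \<inter> snd \<psi> = {}" by blast
  have "\<forall>v\<in>\<Union>K. \<forall>S\<subseteq>{e \<in> K. v \<in> e}. (\<forall>\<phi>\<in>\<Phi>. even (card (S \<inter> fst \<phi>))) \<longrightarrow> S = {} \<or> S = {e \<in> K. v \<in> e}"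
    using ff by (elim conjE)
  then show "v \<in> \<Union>K \<Longrightarrow> S \<subseteq> {e \<in> K. v \<in> e} \<Longrightarrow> (\<And>\<phi>. \<phi> \<in> \<Phi> \<Longrightarrow> even (card (S \<inter> fst \<phi>))) \<Longrightarrow>
       S = {} \<or> S = {e \<in> K. v \<in> e}" by (metis (no_types, lifting))
qed

lemma closed_curve: "F \<subseteq> E \<Longrightarrow> closed (curve F)"
  unfolding curve_def using finite_E arc_edge
  by (intro closed_UN) (auto intro: finite_subset closed_arc_image)

text \<open>The start of the ear construction. The inside is nonempty by the Jordan curve theorem,
  so the two pairs differ; a cycle has as many vertices as edges, which gives Euler's
  formula.\<close>

lemma face_family_cycle:
  assumes F: "is_cycle F" "F \<subseteq> E"
  shows "face_family F {(F, inside (curve F)), (F, outside (curve F))}"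
proof -
  obtain g where g: "simple_path g" "pathfinish g = pathstart g" "path_image g = curve F"
    by (rule cycle_curve[OF F])
  have "inside (curve F) \<noteq> {}" using Jordan_inside_outside[OF g(1,2)] g(3) by simp
  then have ne: "inside (curve F) \<noteq> outside (curve F)"
    using inside_Int_outside[of "curve F"] by (metis Int_absorb)
  have "{\<phi> \<in> {(F, inside (curve F)), (F, outside (curve F))}. e \<in> fst \<phi>} =
      {(F, inside (curve F)), (F, outside (curve F))}" if "e \<in> F" for e
    using that by auto
  \<comment> \<open>Both edges at \<open>v\<close> lie on the boundary of either face, so an even
    subset of them has 0 or 2 elements.\<close>
  moreover have "S = {} \<or> S = {e \<in> F. v \<in> e}"
    if "v \<in> \<Union>F" "S \<subseteq> {e \<in> F. v \<in> e}" "even (card (S \<inter> F))" for v S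
  proof -
    have c: "card {e \<in> F. v \<in> e} = 2" using is_cycle_card_star[OF F(1) that(1)] .
    then have fin: "finite {e \<in> F. v \<in> e}" by (metis card.infinite zero_neq_numeral)
    have "S \<inter> F = S" using that(2) by auto
    then have "even (card S)" using that(3) by simp
    moreover have "card S \<le> 2" using card_mono[OF fin that(2)] c by simp
    ultimately have "card S = 0 \<or> card S = 2" by presburger
    then show ?thesis
    proof
      assume "card S = 0"
      then show ?thesis using finite_subset[OF that(2) fin] by simp
    next
      assume "card S = 2"
      then show ?thesis using card_subset_eq[OF fin that(2)] c by simp
    qed
  qed
  moreover have no: "z \<in> inside (curve F) \<Longrightarrow> z \<notin> curve F" "z \<in> outside (curve F) \<Longrightarrow> z \<notin> curve F" for z
    using inside_no_overlap outside_no_overlap by blast+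
  ultimately show ?thesis
    unfolding face_family_def sides_def using F ne is_cycle_card(1)[OF F(1)]
    using inside_Un_outside[of "curve F"] inside_Int_outside[of "curve F"]
    by (auto simp: Int_commute dest: no)
qed

lemma connected_subset_side:
  assumes "R \<in> sides F" "connected A" "A \<inter> curve F = {}" "A \<inter> R \<noteq> {}"
  shows "A \<subseteq> R"
proof -
  have "R = inside (curve F) \<or> R = outside (curve F)" using assms(1) by (simp add: sides_def)
  then show ?thesis
    using connected_subset_inside[OF assms(2,3)] connected_subset_outside[OF assms(2,3)] assms(4) by metis
qed

text \<open>The closure of a Jordan domain adds only points of its boundary curve, and the curve of
  \<open>F\<close> passes only through vertices of \<open>F\<close>.\<close>

lemma vertex_in_closure_side:
  assumes "R \<in> sides F" "F \<subseteq> E" "v \<in> \<Union>E" "p v \<in> closure R" "p v \<notin> R"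
  shows "v \<in> \<Union>F"
proof -
  have "closure R \<subseteq> curve F \<union> R"
    using assms(1) closure_inside_subset[OF closed_curve[OF assms(2)]]
      closure_outside_subset[OF closed_curve[OF assms(2)]] unfolding sides_def by auto
  then show ?thesis using assms vertex_on_curve_iff[OF assms(2,3)] by blast
qed

text \<open>The open ear is connected and avoids the drawing of \<open>K\<close>, so a single face
  contains it. Its ends are limit points of this face without lying in it, hence belong to the
  boundary.\<close>

lemma face_containing_ear:
  assumes ff: "face_family K \<Phi>" and P: "path_edges (a # zs @ [b]) \<subseteq> E" "path_edges (a # zs @ [b]) \<inter> K = {}"
    and ab: "a \<in> \<Union>K" "b \<in> \<Union>K" "set zs \<inter> \<Union>K = {}" "distinct (a # zs @ [b])"
  obtains F R where "(F, R) \<in> \<Phi>" "curve (path_edges (a # zs @ [b])) - {p a, p b} \<subseteq> R" "a \<in> \<Union>F" "b \<in> \<Union>F"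
proof -
  let ?P = "path_edges (a # zs @ [b])"
  note D = face_familyD[OF ff]
  note K = D(1)
  obtain g where g: "arc g" "path_image g = curve ?P" "pathstart g = p a" "pathfinish g = p b"
    using path_arc[OF ab(4) _ P(1)] by auto
  let ?A = "curve ?P - {p a, p b}"
  have con: "connected ?A" "?A \<noteq> {}"
    using connected_simple_path_endless[of g] nonempty_simple_path_endless[of g] g
    by (auto simp: arc_imp_simple_path)
  have cl: "p a \<in> closure ?A" "p b \<in> closure ?A" using closure_arc_endless[OF g(1)] g by auto
  have U: "\<Union>?P = insert a (insert b (set zs))" by (subst Union_path_edges) auto
  then have "\<Union>?P \<inter> \<Union>K = {a, b}" using ab(1-3) by auto
  then have "curve ?P \<inter> curve K \<subseteq> p ` {a, b}" using curve_Int[OF P(1) K P(2)] by metis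
  then have disj: "?A \<inter> curve K = {}" by auto
  obtain z where z: "z \<in> ?A" using con by blast
  then have "z \<notin> curve K" using disj by blast
  then obtain F R where FR: "(F, R) \<in> \<Phi>" "z \<in> R" using D(9) by blast
  note F = D(4)[OF FR(1)] D(6,7)[OF FR(1)]
  have "?A \<inter> curve F = {}" using disj curve_mono[OF F(1)] by blast
  then have "?A \<subseteq> R" using connected_subset_side[OF F(2) con(1)] z FR(2) by blast
  then have "closure ?A \<subseteq> closure R" by (rule closure_mono)
  moreover have v: "a \<in> \<Union>E" "b \<in> \<Union>E" using ab K by blast+
  moreover have "p a \<notin> R" "p b \<notin> R" using vertex_on_curve_iff[OF K] v ab F(3) by blast+
  ultimately have "a \<in> \<Union>F" "b \<in> \<Union>F"
    using vertex_in_closure_side[OF F(2)] F(1) K cl by blast+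
  then show thesis using that FR(1) \<open>?A \<subseteq> R\<close> by blast
qed

text \<open>The ends of the ear \<open>P\<close> cut the boundary of the face around it into paths
  \<open>X\<close> and \<open>Y\<close>. The face is replaced by two with boundaries
  \<open>X \<union> P\<close> and \<open>Y \<union> P\<close>, and all other faces stay.\<close>

lemma face_family_add_ear:
  assumes ff: "face_family K \<Phi>" and P: "path_edges (a # zs @ [b]) \<subseteq> E" "path_edges (a # zs @ [b]) \<inter> K = {}"
    and ab: "a \<in> \<Union>K" "b \<in> \<Union>K" "set zs \<inter> \<Union>K = {}" "distinct (a # zs @ [b])"
  shows "\<exists>\<Phi>'. face_family (K \<union> path_edges (a # zs @ [b])) \<Phi>'"
proof -
  define P where "P = path_edges (a # zs @ [b])"
  obtain F R where FR: "(F, R) \<in> \<Phi>" "curve P - {p a, p b} \<subseteq> R" "a \<in> \<Union>F" "b \<in> \<Union>F"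
    unfolding P_def by (rule face_containing_ear[OF assms])
  note D = face_familyD[OF ff]
  note K = D(1,2)
  have PE: "P \<subseteq> E" "P \<inter> K = {}" using P unfolding P_def by auto
  have F: "F \<subseteq> K" "is_cycle F" "R \<in> sides F" "R \<inter> curve K = {}" using D(4-7)[OF FR(1)] by auto
  obtain xs ys where s: "distinct (a # xs @ b # ys)" "xs \<noteq> [] \<or> ys \<noteq> []"
    "F = path_edges (a # xs @ [b]) \<union> path_edges (a # ys @ [b])"
    "path_edges (a # xs @ [b]) \<inter> path_edges (a # ys @ [b]) = {}"
    "\<Union>F = set (a # xs @ b # ys)"
    by (rule is_cycle_split[OF F(2) FR(3,4)]) (use ab(4) in auto)
  define X Y where "X = path_edges (a # xs @ [b])" "Y = path_edges (a # ys @ [b])"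
  note XY = X_Y_def[symmetric] P_def[symmetric]
  have FXY: "F = X \<union> Y" "X \<inter> Y = {}" using s(3,4) unfolding XY by auto
  have sub: "X \<subseteq> K" "Y \<subseteq> K" "X \<inter> P = {}" "Y \<inter> P = {}" using FXY F(1) PE by auto
  have zs: "set zs \<inter> set (a # xs @ b # ys) = {}" "distinct zs"
    using ab(3,4) Union_mono[OF F(1)] unfolding s(5) by auto
  obtain c1 c2 c where th: "theta_curve (p a) (p b) c1 c2 c" "path_image c1 = curve X"
     "path_image c2 = curve Y" "path_image c = curve P"
    using paths_theta_curve[OF s(1) zs] sub PE K(1) FXY(2) unfolding XY by blast
  obtain R1 R2 where R: "R1 \<in> sides (X \<union> P)" "R2 \<in> sides (Y \<union> P)" "R1 \<inter> R2 = {}"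
      "R1 \<union> R2 \<union> (curve P - {p a, p b}) = R"
    using theta_curve_split[OF th(1), of R] F(3) FR(2) unfolding th(2-4) sides_def FXY(1) curve_Un
    by metis
  have cyc: "is_cycle (X \<union> P)" "is_cycle (Y \<union> P)"
  proof -
    \<comment> \<open>Otherwise the ear and a boundary path would both be the edge
      \<open>{a, b}\<close>, but the ear has no edge in \<open>K\<close>.\<close>
    have "xs \<noteq> [] \<or> zs \<noteq> []" "ys \<noteq> [] \<or> zs \<noteq> []"
      using sub(3,4) unfolding X_Y_def P_def by auto
    then show "is_cycle (X \<union> P)" "is_cycle (Y \<union> P)"
      unfolding X_Y_def P_def using s(1) zs by (auto intro!: is_cycleI)
  qed
  have Pne: "P \<noteq> {}" unfolding P_def by (cases zs) auto
  have XY_ne: "X \<noteq> Y"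
  proof -
    have "X \<noteq> {}" unfolding X_Y_def by (cases xs) auto
    then show ?thesis using FXY(2) by auto
  qed
  define \<Phi>' where "\<Phi>' = insert (X \<union> P, R1) (insert (Y \<union> P, R2) (\<Phi> - {(F, R)}))"
  have old: "fst \<phi> \<subseteq> K" if "\<phi> \<in> \<Phi>" for \<phi> using D(4)[of "fst \<phi>" "snd \<phi>"] that by simp
  \<comment> \<open>The new boundaries contain edges of \<open>P\<close>, and no old boundary
    does.\<close>
  have new1: "(X \<union> P, R1) \<notin> \<Phi>" "(Y \<union> P, R2) \<notin> \<Phi>" using old Pne PE(2) by fastforce+
  have new2: "(X \<union> P, R1) \<noteq> (Y \<union> P, R2)" using XY_ne sub(3,4) by auto
  have finP: "finite P" by (simp add: P_def)
  have finK: "finite K" using K(1) finite_E finite_subset by blast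
  have finU: "finite (\<Union>K)"
    using finK K(1) card_edge by (metis card.infinite finite_Union subsetD zero_neq_numeral)
  have card\<Phi>: "card \<Phi>' = card \<Phi> + 1"
    unfolding \<Phi>'_def using new1 new2 K(2) card_Suc_Diff1[OF K(2) FR(1)] by simp
  have "card (K \<union> P) + 2 = card \<Phi>' + card (\<Union>(K \<union> P))"
  proof -
    \<comment> \<open>The ear has one edge more than inner vertices, which balances the additional
      face in Euler's formula.\<close>
    have "card P = length zs + 1" using card_path_edges[OF ab(4)] by (simp add: P_def)
    then have "card (K \<union> P) = card K + length zs + 1"
      using card_Un_disjoint[OF finK finP] PE(2) by (simp add: Int_commute)
    moreover have "\<Union>(K \<union> P) = \<Union>K \<union> set zs"
    proof -
      have "\<Union>P = insert a (insert b (set zs))" unfolding P_def by (subst Union_path_edges) auto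
      then show ?thesis using ab(1,2) by auto
    qed
    moreover have "card (\<Union>K \<union> set zs) = card (\<Union>K) + length zs"
      using card_Un_disjoint[OF finU, of "set zs"] ab(3) distinct_card[OF zs(2)] by (simp add: Int_commute)
    ultimately show ?thesis using card\<Phi> D(3) by simp
  qed
  moreover have "(\<forall>(F, R)\<in>\<Phi>'. F \<subseteq> K \<union> P \<and> is_cycle F \<and> R \<in> sides F \<and> R \<inter> curve (K \<union> P) = {})"
  proof -
    have no: "R' \<inter> curve F' = {}" if "R' \<in> sides F'" for F' R'
      using that inside_no_overlap outside_no_overlap unfolding sides_def by blast
    have "R1 \<inter> curve (K \<union> P) = {}" "R2 \<inter> curve (K \<union> P) = {}"
      using no[OF R(1)] no[OF R(2)] R(4) F(4) unfolding curve_Un by blast+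
    \<comment> \<open>The other faces are disjoint from \<open>R\<close>, which contains the open
      ear, and the ends of the ear lie on the drawing of \<open>K\<close>.\<close>
    moreover have old': "R' \<inter> curve (K \<union> P) = {}" if "(F', R') \<in> \<Phi> - {(F, R)}" for F' R'
    proof -
      have K': "R' \<inter> curve K = {}" "R' \<inter> R = {}"
        using that D(7)[of F' R'] D(8)[of "(F', R')" "(F, R)"] FR(1) by auto
      moreover have "p a \<in> curve K" "p b \<in> curve K"
        using vertex_on_curve_iff[OF K(1)] ab(1,2) K(1) by blast+
      ultimately show ?thesis using FR(2) unfolding curve_Un by blast
    qed
    ultimately have "F' \<subseteq> K \<union> P \<and> is_cycle F' \<and> R' \<in> sides F' \<and> R' \<inter> curve (K \<union> P) = {}"
      if "(F', R') = (X \<union> P, R1) \<or> (F', R') = (Y \<union> P, R2) \<or> (F', R') \<in> \<Phi> - {(F, R)}" for F' R'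
      using that
    proof (elim disjE)
      assume "(F', R') = (X \<union> P, R1)"
      then show ?thesis using cyc R(1) sub(1) \<open>R1 \<inter> curve (K \<union> P) = {}\<close> by auto
    next
      assume "(F', R') = (Y \<union> P, R2)"
      then show ?thesis using cyc R(2) sub(2) \<open>R2 \<inter> curve (K \<union> P) = {}\<close> by auto
    next
      assume *: "(F', R') \<in> \<Phi> - {(F, R)}"
      then have "(F', R') \<in> \<Phi>" by simp
      then show ?thesis using old' * D(4-6)[of F' R'] by auto
    qed
    note step = this
    show ?thesis
    proof
      fix \<phi> assume "\<phi> \<in> \<Phi>'"
      then have "(fst \<phi>, snd \<phi>) = (X \<union> P, R1) \<or> (fst \<phi>, snd \<phi>) = (Y \<union> P, R2) \<or>
          (fst \<phi>, snd \<phi>) \<in> \<Phi> - {(F, R)}"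
        unfolding \<Phi>'_def insert_iff prod.collapse .
      then show "case \<phi> of (F, R) \<Rightarrow> F \<subseteq> K \<union> P \<and> is_cycle F \<and> R \<in> sides F \<and> R \<inter> curve (K \<union> P) = {}"
        unfolding case_prod_unfold by (rule step)
    qed
  qed
  moreover have "\<forall>\<phi>\<in>\<Phi>'. \<forall>\<psi>\<in>\<Phi>'. \<phi> \<noteq> \<psi> \<longrightarrow> snd \<phi> \<inter> snd \<psi> = {}"
  proof -
    have "snd \<phi> \<inter> R = {}" if "\<phi> \<in> \<Phi> - {(F, R)}" for \<phi>
      using that D(8)[of \<phi> "(F, R)"] FR(1) by auto
    then have "snd \<phi> \<inter> R1 = {}" "snd \<phi> \<inter> R2 = {}" if "\<phi> \<in> \<Phi> - {(F, R)}" for \<phi>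
      using that R(4) by blast+
    then show ?thesis unfolding \<Phi>'_def using R(3) D(8) by (auto simp: Int_commute)
  qed
  moreover have "- curve (K \<union> P) \<subseteq> \<Union>(snd ` \<Phi>')"
  proof
    fix z assume z: "z \<in> - curve (K \<union> P)"
    then have zP: "z \<notin> curve P" and "z \<in> - curve K" by (auto simp: curve_Un)
    then obtain F' R' where F': "(F', R') \<in> \<Phi>" "z \<in> R'" using D(9) by blast
    show "z \<in> \<Union>(snd ` \<Phi>')"
    proof (cases "(F', R') = (F, R)")
      case True
      then have "z \<in> R1 \<union> R2" using F'(2) R(4) zP by blast
      then show ?thesis unfolding \<Phi>'_def by auto
    next
      case False
      then show ?thesis unfolding \<Phi>'_def using F' by force
    qed
  qed
  moreover have "\<forall>e\<in>K \<union> P. card {\<phi> \<in> \<Phi>'. e \<in> fst \<phi>} = 2"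
  proof
    fix e assume e: "e \<in> K \<union> P"
    \<comment> \<open>The surviving old faces at \<open>e\<close>: none if \<open>e\<close> is in
      \<open>P\<close>, one if it is on \<open>F\<close>, two otherwise.\<close>
    define N where "N = {\<phi> \<in> \<Phi> - {(F, R)}. e \<in> fst \<phi>}"
    have finN: "finite N" using K(2) by (simp add: N_def)
    have nN: "(X \<union> P, R1) \<notin> N" "(Y \<union> P, R2) \<notin> N" using new1 by (auto simp: N_def)
    have "{\<phi> \<in> insert A (insert B C). Q \<phi>} = (if Q A then {A} else {}) \<union> (if Q B then {B} else {}) \<union> {\<phi> \<in> C. Q \<phi>}"
      for A B :: "'a set set \<times> complex set" and C Q by auto
    then have eq: "{\<phi> \<in> \<Phi>'. e \<in> fst \<phi>} = (if e \<in> X \<union> P then {(X \<union> P, R1)} else {}) \<union>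
        (if e \<in> Y \<union> P then {(Y \<union> P, R2)} else {}) \<union> N"
      unfolding \<Phi>'_def N_def by (simp only: fst_conv)
    show "card {\<phi> \<in> \<Phi>'. e \<in> fst \<phi>} = 2"
    proof (cases "e \<in> P")
      case True
      then have "N = {}" using old PE(2) unfolding N_def by blast
      then have "{\<phi> \<in> \<Phi>'. e \<in> fst \<phi>} = {(X \<union> P, R1), (Y \<union> P, R2)}"
        using True unfolding eq by (simp add: insert_commute)
      then show ?thesis using new2 by simp
    next
      case False
      then have c2: "card {\<phi> \<in> \<Phi>. e \<in> fst \<phi>} = 2" using e D(10) by blast
      show ?thesis
      proof (cases "e \<in> F")
        case True
        then have "{\<phi> \<in> \<Phi>. e \<in> fst \<phi>} = insert (F, R) N" using FR(1) by (auto simp: N_def)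
        moreover have "(F, R) \<notin> N" by (simp add: N_def)
        ultimately have N1: "card N = 1" using c2 finN by simp
        show ?thesis
        proof (cases "e \<in> X")
          case True
          then have "e \<notin> Y" using FXY(2) by blast
          then have "{\<phi> \<in> \<Phi>'. e \<in> fst \<phi>} = insert (X \<union> P, R1) N"
            using True \<open>e \<notin> P\<close> unfolding eq by simp
          then show ?thesis using N1 nN finN by simp
        next
          case False
          then have "e \<in> Y" using FXY(1) \<open>e \<in> F\<close> by blast
          then have "{\<phi> \<in> \<Phi>'. e \<in> fst \<phi>} = insert (Y \<union> P, R2) N"
            using False \<open>e \<notin> P\<close> unfolding eq by simp
          then show ?thesis using N1 nN finN by simp
        qed
      next
        case eF: False
        have "{\<phi> \<in> \<Phi>. e \<in> fst \<phi>} = N" using eF by (auto simp: N_def)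
        then have "{\<phi> \<in> \<Phi>'. e \<in> fst \<phi>} = {\<phi> \<in> \<Phi>. e \<in> fst \<phi>}"
          using eF False unfolding eq FXY(1) by simp
        then show ?thesis using c2 by simp
      qed
    qed
  qed
  moreover have "S = {} \<or> S = {e \<in> K \<union> P. v \<in> e}"
    if v: "v \<in> \<Union>(K \<union> P)" and S: "S \<subseteq> {e \<in> K \<union> P. v \<in> e}"
      and ev: "\<forall>\<phi>\<in>\<Phi>'. even (card (S \<inter> fst \<phi>))" for v S
  proof -
    have "S \<subseteq> K \<union> P" using S by auto
    then have finS: "finite S" using finK finP finite_subset by blast
    have evX: "even (card (S \<inter> (X \<union> P)))" "even (card (S \<inter> (Y \<union> P)))"
      using ev unfolding \<Phi>'_def by auto
    have cX: "card (S \<inter> (X \<union> P)) = card (S \<inter> X) + card (S \<inter> P)"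
      "card (S \<inter> (Y \<union> P)) = card (S \<inter> Y) + card (S \<inter> P)"
      "card (S \<inter> F) = card (S \<inter> X) + card (S \<inter> Y)"
      unfolding FXY(1) Int_Un_distrib
      by (rule card_Un_disjoint; use finS sub(3,4) FXY(2) in blast)+
    have starX: "\<exists>e. {e \<in> X. v \<in> e} = {e}" if "v = a \<or> v = b"
    proof (cases "v = a")
      case True
      have "{e \<in> path_edges (a # (xs @ [b])). a \<in> e} = {{a, hd (xs @ [b])}}"
        by (rule star_path_edges_hd) (use s(1) in auto)
      then show ?thesis using True by (auto simp: X_Y_def)
    next
      case False
      have "{e \<in> path_edges (b # (rev xs @ [a])). b \<in> e} = {{b, hd (rev xs @ [a])}}"
        by (rule star_path_edges_hd) (use s(1) in auto)
      moreover have "path_edges (b # (rev xs @ [a])) = X"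
        using path_edges_rev[of "a # xs @ [b]"] by (simp add: X_Y_def)
      ultimately show ?thesis using False that by auto
    qed
    have starP: "\<exists>e. {e \<in> P. v \<in> e} = {e}" if "v = a \<or> v = b"
    proof (cases "v = a")
      case True
      have "{e \<in> path_edges (a # (zs @ [b])). a \<in> e} = {{a, hd (zs @ [b])}}"
        by (rule star_path_edges_hd) (use ab(4) in auto)
      then show ?thesis using True by (auto simp: P_def)
    next
      case False
      have "{e \<in> path_edges (b # (rev zs @ [a])). b \<in> e} = {{b, hd (rev zs @ [a])}}"
        by (rule star_path_edges_hd) (use ab(4) in auto)
      moreover have "path_edges (b # (rev zs @ [a])) = P"
        using path_edges_rev[of "a # zs @ [b]"] by (simp add: P_def)
      ultimately show ?thesis using False that by auto
    qed
    have UP: "\<Union>P = insert a (insert b (set zs))" unfolding P_def by (subst Union_path_edges) auto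
    show ?thesis
    proof (cases "v \<in> \<Union>K")
      case True
      have "S \<inter> K \<subseteq> {e \<in> K. v \<in> e}" using S by auto
      moreover have "even (card (S \<inter> K \<inter> fst \<phi>))" if "\<phi> \<in> \<Phi>" for \<phi>
      proof -
        have "S \<inter> K \<inter> fst \<phi> = S \<inter> fst \<phi>" using old[OF that] by blast
        moreover have "even (card (S \<inter> fst \<phi>))"
        proof (cases "\<phi> = (F, R)")
          case True
          \<comment> \<open>Adding the parities for \<open>X \<union> P\<close> and
            \<open>Y \<union> P\<close> cancels \<open>P\<close> modulo 2, so the parity condition
            also holds for the replaced face.\<close>
          have "even (card (S \<inter> X) + card (S \<inter> Y))" using evX unfolding cX by presburger
          then show ?thesis using True cX(3) by simp
        next
          case False
          then show ?thesis using ev that unfolding \<Phi>'_def by blast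
        qed
        ultimately show ?thesis by simp
      qed
      ultimately have alt: "S \<inter> K = {} \<or> S \<inter> K = {e \<in> K. v \<in> e}" using D(11) True by blast
      show ?thesis
      proof (cases "v = a \<or> v = b")
        case vab: True
        \<comment> \<open>At an end of the ear there is one edge of \<open>X\<close> and one of
          \<open>P\<close>. Evenness on \<open>X \<union> P\<close> forces the new edge to be in
          \<open>S\<close> exactly if the old star is.\<close>
        obtain e where e: "{e \<in> P. v \<in> e} = {e}" using starP[OF vab] by blast
        obtain f where f: "{e \<in> X. v \<in> e} = {f}" using starX[OF vab] by blast
        have SP: "S \<inter> P \<subseteq> {e}" using S e by blast
        from alt show ?thesis
        proof
          assume SK: "S \<inter> K = {}"
          then have "S \<inter> X = {}" using sub(1) by blast
          then have "even (card (S \<inter> P))" using evX(1) cX(1) by simp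
          then have "S \<inter> P = {}" using SP by (auto simp: subset_singleton_iff)
          then show ?thesis using S SK by blast
        next
          assume SK: "S \<inter> K = {e \<in> K. v \<in> e}"
          then have "S \<inter> X = {f}" using sub(1) f by blast
          then have "odd (card (S \<inter> P))" using evX(1) cX(1) by simp
          then have "S \<inter> P = {e}" using SP by (auto simp: subset_singleton_iff)
          then have "S = {e \<in> K \<union> P. v \<in> e}" using S SK e by blast
          then show ?thesis ..
        qed
      next
        case False
        then have "v \<notin> \<Union>P" using UP True ab(3) by auto
        then have "S \<inter> K = S" "{e \<in> K \<union> P. v \<in> e} = {e \<in> K. v \<in> e}" using S by blast+
        then show ?thesis using alt by simp
      qed
    next
      case False
      \<comment> \<open>An inner vertex of the ear has only two edges, both on the cycle
        \<open>X \<union> P\<close>.\<close>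
      then have vP: "v \<in> \<Union>P" using v by blast
      have st: "{e \<in> K \<union> P. v \<in> e} = {e \<in> X \<union> P. v \<in> e}" using False sub(1) by blast
      have c: "card {e \<in> X \<union> P. v \<in> e} = 2" using is_cycle_card_star[OF cyc(1)] vP by blast
      then have fin: "finite {e \<in> X \<union> P. v \<in> e}" by (metis card.infinite zero_neq_numeral)
      have S': "S \<subseteq> {e \<in> X \<union> P. v \<in> e}" using S st by simp
      then have "S \<inter> (X \<union> P) = S" by auto
      then have "even (card S)" using evX(1) by simp
      moreover have "card S \<le> 2" using card_mono[OF fin S'] c by simp
      ultimately have "card S = 0 \<or> card S = 2" by presburger
      then show ?thesis
      proof
        assume "card S = 0"
        then show ?thesis using finS by simp
      next
        assume "card S = 2"
        then show ?thesis using card_subset_eq[OF fin S'] c st by simp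
      qed
    qed
  qed
  ultimately have "face_family (K \<union> P) \<Phi>'"
    unfolding face_family_def using K PE(1) by (simp add: \<Phi>'_def)
  then show ?thesis unfolding P_def by blast
qed

end

section \<open>Ear decompositions\<close>

text \<open>The graph with vertex set \<open>\<Union>E\<close> is connected and has no cut vertex.\<close>

definition nonseparable :: "'a set set \<Rightarrow> bool" where
  "nonseparable E \<longleftrightarrow> (\<forall>a\<in>\<Union>E. \<forall>U. U \<noteq> {} \<longrightarrow> U \<subseteq> \<Union>E - {a} \<longrightarrow>
     (\<forall>e\<in>E. e \<inter> U \<noteq> {} \<longrightarrow> e \<subseteq> insert a U) \<longrightarrow> U = \<Union>E - {a})"

lemma nonseparableD:
  assumes "nonseparable E" "a \<in> \<Union>E" "U \<noteq> {}" "U \<subseteq> \<Union>E - {a}"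
    "\<And>e. e \<in> E \<Longrightarrow> e \<inter> U \<noteq> {} \<Longrightarrow> e \<subseteq> insert a U"
  shows "U = \<Union>E - {a}"
  using assms(1)[unfolded nonseparable_def, rule_format, OF assms(2-4)] assms(5) by simp

lemma path_edges_snoc: "xs \<noteq> [] \<Longrightarrow> path_edges (xs @ [w]) = insert {last xs, w} (path_edges xs)"
  by (induction xs rule: path_edges.induct) auto

text \<open>Let \<open>U\<close> be the set of vertices reachable from \<open>y\<close> by paths
  that avoid \<open>a\<close> and \<open>Z\<close>. If no path entered \<open>Z\<close>, then edges
  could leave \<open>U\<close> only towards \<open>a\<close>, so \<open>U\<close> would contain all
  vertices other than \<open>a\<close>, among them those of \<open>Z\<close>.\<close>

lemma nonseparable_path:
  assumes ns: "nonseparable E" and c2: "\<And>e. e \<in> E \<Longrightarrow> card e = 2"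
    and a: "a \<in> \<Union>E" and y: "y \<in> \<Union>E - {a}" and Z: "Z \<subseteq> \<Union>E - {a}" "Z \<noteq> {}"
  shows "\<exists>xs. distinct xs \<and> xs \<noteq> [] \<and> hd xs = y \<and> last xs \<in> Z \<and> set (butlast xs) \<inter> Z = {} \<and>
    path_edges xs \<subseteq> E \<and> a \<notin> set xs"
proof (rule ccontr)
  assume no: "\<not> ?thesis"
  define good where "good xs \<longleftrightarrow> distinct xs \<and> xs \<noteq> [] \<and> hd xs = y \<and> path_edges xs \<subseteq> E \<and> a \<notin> set xs" for xs
  have no': "False" if "good xs" "last xs \<in> Z" "set (butlast xs) \<inter> Z = {}" for xs
    using that no unfolding good_def by blast
  define U where "U = {u. \<exists>xs. good xs \<and> set xs \<inter> Z = {} \<and> last xs = u}"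
  have "good [y]" using y by (auto simp: good_def)
  then have "y \<notin> Z" using no'[of "[y]"] by auto
  then have "y \<in> U" using \<open>good [y]\<close> unfolding U_def by (intro CollectI exI[of _ "[y]"]) simp
  have "U \<subseteq> \<Union>E - {a}"
  proof
    fix u assume "u \<in> U"
    then obtain xs where xs: "good xs" "last xs = u" by (auto simp: U_def)
    then have "u \<noteq> a" unfolding good_def by auto
    moreover have "u \<in> \<Union>E"
    proof (cases "2 \<le> length xs")
      case True
      then have "\<Union>(path_edges xs) = set xs" by (rule Union_path_edges)
      then show ?thesis using xs unfolding good_def by (metis Union_mono last_in_set subsetD)
    next
      case False
      then have "xs = [y]" using xs unfolding good_def by (cases xs rule: path_edges.cases) auto
      then show ?thesis using xs y by auto
    qed
    ultimately show "u \<in> \<Union>E - {a}" by blast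
  qed
  moreover have "e \<subseteq> insert a U" if e: "e \<in> E" "e \<inter> U \<noteq> {}" for e
  proof
    fix w assume w: "w \<in> e"
    show "w \<in> insert a U"
    proof (rule ccontr)
      assume wU: "w \<notin> insert a U"
      obtain u where u: "u \<in> e" "u \<in> U" using e(2) by blast
      then have "u \<noteq> w" using wU by auto
      then have euw: "e = {u, w}" using c2[OF e(1)] u(1) w
        by (metis card_2_iff doubleton_eq_iff insert_iff singletonD)
      obtain xs where xs: "good xs" "last xs = u" "set xs \<inter> Z = {}" using u by (auto simp: U_def)
      show False
      proof (cases "w \<in> set xs")
        case True
        \<comment> \<open>If \<open>w\<close> is already on the path, the initial segment that ends
          in \<open>w\<close> shows that \<open>w\<close> is in \<open>U\<close>.\<close>
        then obtain ys zs where s: "xs = ys @ w # zs" by (auto simp: in_set_conv_decomp)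
        have "path_edges xs = path_edges (ys @ [w]) \<union> path_edges (w # zs)"
          unfolding s by (rule path_edges_append)
        then have "good (ys @ [w])" using xs(1) s unfolding good_def by (cases ys) auto
        then have "w \<in> U" using xs(3) s unfolding U_def by (intro CollectI exI[of _ "ys @ [w]"]) auto
        then show False using wU by simp
      next
        case False
        have g: "good (xs @ [w])"
          using xs(1,2) False wU e(1) euw path_edges_snoc[of xs w] unfolding good_def by auto
        show False
        proof (cases "w \<in> Z")
          case True
          then show False using no'[OF g] xs(3) by simp
        next
          case False
          then have "w \<in> U" using g xs(3) unfolding U_def by (intro CollectI exI[of _ "xs @ [w]"]) auto
          then show False using wU by simp
        qed
      qed
    qed
  qed
  ultimately have "U = \<Union>E - {a}"
    using \<open>y \<in> U\<close> by (intro nonseparableD[OF ns a]) auto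
  moreover have "u \<notin> Z" if u: "u \<in> U" for u
  proof -
    obtain xs where xs: "good xs" "set xs \<inter> Z = {}" "last xs = u" using u by (auto simp: U_def)
    then have "u \<in> set xs" using last_in_set[of xs] by (simp add: good_def)
    then show ?thesis using xs(2) by blast
  qed
  ultimately show False using Z by blast
qed

text \<open>Supplies the first cycle of the ear decomposition: a path from \<open>y\<close> to
  \<open>z\<close> that avoids \<open>v\<close> is closed by the two edges at
  \<open>v\<close>.\<close>

lemma nonseparable_cycle:
  assumes ns: "nonseparable E" and c2: "\<And>e. e \<in> E \<Longrightarrow> card e = 2"
    and e: "{v, y} \<in> E" "{v, z} \<in> E" "y \<noteq> z"
  obtains F where "is_cycle F" "F \<subseteq> E"
proof -
  have ne: "v \<noteq> y" "v \<noteq> z" using c2[OF e(1)] c2[OF e(2)] by auto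
  have "y \<in> \<Union>E - {v}" "{z} \<subseteq> \<Union>E - {v}" "v \<in> \<Union>E" using e ne by auto
  then obtain xs where xs: "distinct xs" "xs \<noteq> []" "hd xs = y" "last xs \<in> {z}"
    "path_edges xs \<subseteq> E" "v \<notin> set xs"
    using nonseparable_path[OF ns c2, of v y "{z}"] by blast
  obtain us where us: "xs = y # us" using xs(2,3) by (cases xs) auto
  then have "us \<noteq> []" using xs(4) e(3) by auto
  have "path_edges ((v # xs) @ [v]) = insert {z, v} (path_edges (v # xs))"
    using path_edges_snoc[of "v # xs" v] xs(2,4) by simp
  also have "path_edges (v # xs) = insert {v, y} (path_edges xs)" using us by simp
  finally have "path_edges ((v # xs) @ [hd (v # xs)]) \<subseteq> E" using e(1,2) xs(5) by (simp add: insert_commute)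
  moreover have "is_cycle (path_edges ((v # xs) @ [hd (v # xs)]))"
    unfolding is_cycle_def
    by (rule exI[of _ "v # xs"]) (use xs us \<open>us \<noteq> []\<close> in \<open>cases us; auto\<close>)
  ultimately show thesis using that by blast
qed

text \<open>If \<open>K\<close> covers all vertices, any missing edge is an ear. Otherwise an edge
  leaves \<open>K\<close> at some \<open>a\<close>, and a path avoiding \<open>a\<close> leads from
  its other end back to \<open>K\<close>.\<close>

lemma nonseparable_ear:
  assumes ns: "nonseparable E" and c2: "\<And>e. e \<in> E \<Longrightarrow> card e = 2"
    and K: "K \<subseteq> E" "K \<noteq> E" "K \<noteq> {}"
  obtains a zs b where "path_edges (a # zs @ [b]) \<subseteq> E" "path_edges (a # zs @ [b]) \<inter> K = {}"
    "a \<in> \<Union>K" "b \<in> \<Union>K" "set zs \<inter> \<Union>K = {}" "distinct (a # zs @ [b])"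
proof (cases "\<Union>K = \<Union>E")
  case True
  obtain e where e: "e \<in> E" "e \<notin> K" using K by blast
  obtain a b where ab: "e = {a, b}" "a \<noteq> b" using c2[OF e(1)] by (auto simp: card_2_iff)
  show thesis by (rule that[of a "[]" b]) (use e ab True in auto)
next
  case False
  have UK: "\<Union>K \<subseteq> \<Union>E" using K by blast
  obtain k where k: "k \<in> K" using K by blast
  obtain k1 k2 where k12: "k1 \<in> \<Union>K" "k2 \<in> \<Union>K" "k1 \<noteq> k2"
  proof -
    have "card k = 2" using c2 k K(1) by blast
    then obtain x y where "k = {x, y}" "x \<noteq> y" unfolding card_2_iff by blast
    then show thesis using k by (intro that[of x y]) auto
  qed
  \<comment> \<open>Without such an edge the vertices outside \<open>K\<close> would have no edges
    to \<open>K\<close>, so nonseparability at \<open>k1\<close> would make them all vertices but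
    \<open>k1\<close>; yet \<open>k2\<close> lies in \<open>K\<close>.\<close>
  have "\<exists>e\<in>E. e \<inter> (\<Union>E - \<Union>K) \<noteq> {} \<and> e \<inter> \<Union>K \<noteq> {}"
  proof (rule ccontr)
    assume no: "\<not> ?thesis"
    have "\<Union>E - \<Union>K = \<Union>E - {k1}"
    proof -
      have "k1 \<in> \<Union>E" "\<Union>E - \<Union>K \<noteq> {}" "\<Union>E - \<Union>K \<subseteq> \<Union>E - {k1}" using k12 UK False by auto
      moreover have "e \<subseteq> insert k1 (\<Union>E - \<Union>K)" if "e \<in> E" "e \<inter> (\<Union>E - \<Union>K) \<noteq> {}" for e
        using that no by blast
      ultimately show ?thesis by (intro nonseparableD[OF ns])
    qed
    then show False using k12 UK by blast
  qed
  then obtain e y a where e: "e \<in> E" "y \<in> e" "y \<notin> \<Union>K" "a \<in> e" "a \<in> \<Union>K" by blast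
  then have "a \<noteq> y" by blast
  then have eay: "e = {a, y}" using c2[OF e(1)] e by (metis card_2_iff doubleton_eq_iff insert_iff singletonD)
  have Z: "\<Union>K - {a} \<subseteq> \<Union>E - {a}" "\<Union>K - {a} \<noteq> {}" using UK k12 by blast+
  have ay: "a \<in> \<Union>E" "y \<in> \<Union>E - {a}" using e \<open>a \<noteq> y\<close> by auto
  obtain xs where xs: "distinct xs" "xs \<noteq> []" "hd xs = y" "last xs \<in> \<Union>K - {a}"
    "set (butlast xs) \<inter> (\<Union>K - {a}) = {}" "path_edges xs \<subseteq> E" "a \<notin> set xs"
    using nonseparable_path[OF ns c2 ay Z] by blast
  obtain zs b where xs': "xs = zs @ [b]" using xs(2) by (cases xs rule: rev_exhaust) auto
  have bK: "b \<in> \<Union>K" "b \<noteq> a" using xs(4) unfolding xs' by auto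
  have zsne: "zs \<noteq> []" using xs(3) bK(1) e(3) unfolding xs' by auto
  have zsK: "set zs \<inter> \<Union>K = {}" using xs(5,7) unfolding xs' by auto
  have "path_edges (a # zs @ [b]) = insert {a, y} (path_edges xs)"
    using xs' xs(3) zsne by (cases zs) auto
  then have sub: "path_edges (a # zs @ [b]) \<subseteq> E" using e(1) eay xs(6) by simp
  have "path_edges (a # zs @ [b]) \<inter> K = {}" using path_edges_meets_inner[OF zsne] zsK by blast
  then show thesis using that[OF sub] e(5) bK zsK xs(1,7) xs' by auto
qed

context plane_graph
begin

text \<open>A maximal subgraph with a face family that contains some cycle must be all of
  \<open>E\<close>, as any further ear could be added.\<close>

theorem face_family_exists:
  assumes ns: "nonseparable E" and e: "{v, y} \<in> E" "{v, z} \<in> E" "y \<noteq> z"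
  obtains \<Phi> where "face_family E \<Phi>"
proof -
  define \<K> where "\<K> = {K. \<exists>\<Phi>. face_family K \<Phi>}"
  have sub: "K \<subseteq> E" if "K \<in> \<K>" for K using that face_familyD(1) unfolding \<K>_def by blast
  obtain F where F: "is_cycle F" "F \<subseteq> E" using nonseparable_cycle[OF ns card_edge e] by blast
  then have FK: "F \<in> \<K>" using face_family_cycle unfolding \<K>_def by blast
  have "\<K> \<subseteq> Pow E" using sub by blast
  then have fin: "finite \<K>" using finite_E by (simp add: finite_subset)
  obtain K where K: "K \<in> \<K>" "F \<subseteq> K" "\<forall>K'\<in>\<K>. K \<subseteq> K' \<longrightarrow> K = K'"
    using finite_has_maximal2[OF fin FK] by blast
  have "K = E"
  proof (rule ccontr)
    assume "K \<noteq> E"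
    moreover have "K \<noteq> {}" using K(2) is_cycle_card(4)[OF F(1)] by blast
    ultimately obtain a zs b where P: "path_edges (a # zs @ [b]) \<subseteq> E" "path_edges (a # zs @ [b]) \<inter> K = {}"
      "a \<in> \<Union>K" "b \<in> \<Union>K" "set zs \<inter> \<Union>K = {}" "distinct (a # zs @ [b])"
      using nonseparable_ear[OF ns card_edge sub[OF K(1)]] by blast
    obtain \<Phi> where "face_family K \<Phi>" using K(1) unfolding \<K>_def by blast
    then have "K \<union> path_edges (a # zs @ [b]) \<in> \<K>"
      using face_family_add_ear[OF _ P] unfolding \<K>_def by blast
    then have "K = K \<union> path_edges (a # zs @ [b])" using K(3) by blast
    moreover have "path_edges (a # zs @ [b]) \<noteq> {}" by (cases zs) auto
    ultimately show False using P(2) by blast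
  qed
  then show thesis using that K(1) unfolding \<K>_def by blast
qed

end

section \<open>Discharging\<close>

lemma is_cycle_card3E:
  assumes "is_cycle F" "card F = 3" "{u, v} \<in> F" "u \<noteq> v"
  obtains w where "distinct [u, v, w]" "F = {{u, v}, {v, w}, {w, u}}"
proof -
  have "u \<in> \<Union>F" using assms(3) by blast
  then obtain xs where xs: "distinct (u # xs)" "F = path_edges (u # xs @ [u])"
    using is_cycle_rotate[OF assms(1)] by metis
  have "\<Union>F = set (u # xs)" unfolding xs(2) by (subst Union_path_edges) auto
  then have "length xs = 2"
    using is_cycle_card(1)[OF assms(1)] assms(2) distinct_card[OF xs(1)] by simp
  then obtain a b where ab: "xs = [a, b]" by (auto simp: length_Suc_conv numeral_2_eq_2)
  then have F: "F = {{u, a}, {a, b}, {b, u}}" using xs(2) by simp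
  then have "v = a \<or> v = b" using assms(3,4) xs(1) ab by (auto simp: doubleton_eq_iff)
  then show thesis
  proof
    assume "v = a"
    then show thesis using that[of b] F xs(1) ab by auto
  next
    assume "v = b"
    then show thesis using that[of a] F xs(1) ab by (auto simp: insert_commute)
  qed
qed

lemma is_cycle_card4E:
  assumes "is_cycle F" "card F = 4" "{u, v} \<in> F" "u \<noteq> v"
  obtains y z where "distinct [u, v, y, z]" "F = {{u, v}, {v, y}, {y, z}, {z, u}}"
proof -
  have "u \<in> \<Union>F" using assms(3) by blast
  then obtain xs where xs: "distinct (u # xs)" "F = path_edges (u # xs @ [u])"
    using is_cycle_rotate[OF assms(1)] by metis
  have "\<Union>F = set (u # xs)" unfolding xs(2) by (subst Union_path_edges) auto
  then have "length xs = 3"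
    using is_cycle_card(1)[OF assms(1)] assms(2) distinct_card[OF xs(1)] by simp
  then obtain a b c where ab: "xs = [a, b, c]" by (auto simp: length_Suc_conv numeral_3_eq_3)
  then have F: "F = {{u, a}, {a, b}, {b, c}, {c, u}}" using xs(2) by simp
  then have "v = a \<or> v = c" using assms(3,4) xs(1) ab by (auto simp: doubleton_eq_iff)
  then show thesis
  proof
    assume "v = a"
    then show thesis using that[of b c] F xs(1) ab by auto
  next
    assume "v = c"
    then show thesis using that[of b a] F xs(1) ab by (auto simp: insert_commute)
  qed
qed

lemma card_triangle:
  assumes "distinct [u, v, w]"
  shows "card {{u, v}, {v, w}, {w, u}} = 3"
proof -
  have "{u, v} \<noteq> {v, w}" "{u, v} \<noteq> {w, u}" "{v, w} \<noteq> {w, u}"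
    using assms by (auto simp: doubleton_eq_iff)
  then show ?thesis by simp
qed

lemma is_cycle_card5I:
  assumes "distinct [a, b, c, d, e]"
  shows "is_cycle {{a, b}, {b, c}, {c, d}, {d, e}, {e, a}}" "card {{a, b}, {b, c}, {c, d}, {d, e}, {e, a}} = 5"
proof -
  show c: "is_cycle {{a, b}, {b, c}, {c, d}, {d, e}, {e, a}}"
    unfolding is_cycle_def by (rule exI[of _ "[a, b, c, d, e]"]) (use assms in simp)
  have "\<Union>{{a, b}, {b, c}, {c, d}, {d, e}, {e, a}} = set [a, b, c, d, e]" by auto
  then show "card {{a, b}, {b, c}, {c, d}, {d, e}, {e, a}} = 5"
    using is_cycle_card(1)[OF c] distinct_card[OF assms] by simp
qed

text \<open>Only combinatorial data of the drawing remain. Faces are indices with a boundary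
  \<open>fc\<close>, since different faces may have the same boundary. The vertex \<open>x\<close>
  stands for the cut vertex of an end block, which is exempt from the degree conditions.\<close>

locale discharging =
  fixes E :: "'a set set" and \<Phi> :: "'i set" and fc :: "'i \<Rightarrow> 'a set set" and x :: 'a
  assumes finite_E: "finite E" and card_edge: "e \<in> E \<Longrightarrow> card e = 2" and finite_\<Phi>: "finite \<Phi>"
    and euler: "card E + 2 = card \<Phi> + card (\<Union>E)"
    and face_cycle: "\<phi> \<in> \<Phi> \<Longrightarrow> is_cycle (fc \<phi>)" and face_subset: "\<phi> \<in> \<Phi> \<Longrightarrow> fc \<phi> \<subseteq> E"
    and two_faces: "e \<in> E \<Longrightarrow> card {\<phi> \<in> \<Phi>. e \<in> fc \<phi>} = 2"
    and parity: "v \<in> \<Union>E \<Longrightarrow> S \<subseteq> {e \<in> E. v \<in> e} \<Longrightarrow> (\<And>\<phi>. \<phi> \<in> \<Phi> \<Longrightarrow> even (card (S \<inter> fc \<phi>))) \<Longrightarrow>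
       S = {} \<or> S = {e \<in> E. v \<in> e}"
    and no56: "is_cycle F \<Longrightarrow> F \<subseteq> E \<Longrightarrow> card F \<noteq> 5 \<and> card F \<noteq> 6"
    and x: "x \<in> \<Union>E"
    and deg_ge3: "v \<in> \<Union>E \<Longrightarrow> v \<noteq> x \<Longrightarrow> 3 \<le> card {e \<in> E. v \<in> e}"
    and deg3: "{u, v} \<in> E \<Longrightarrow> v \<noteq> x \<Longrightarrow> u \<noteq> x \<Longrightarrow> card {e \<in> E. v \<in> e} = 3 \<Longrightarrow> 7 \<le> card {e \<in> E. u \<in> e}"
    and deg4: "{u, v} \<in> E \<Longrightarrow> v \<noteq> x \<Longrightarrow> u \<noteq> x \<Longrightarrow> card {e \<in> E. v \<in> e} = 4 \<Longrightarrow> 6 \<le> card {e \<in> E. u \<in> e}"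
begin

definition deg :: "'a \<Rightarrow> nat" where "deg v = card {e \<in> E. v \<in> e}"

text \<open>Since \<open>share v * deg v = 2 * deg v - 6\<close> for \<open>v \<noteq> x\<close>, the constant 4 below gives \<open>x\<close> a surplus of \<open>10 < 12\<close>.
  The share of \<open>x\<close> is 4 if \<open>x\<close> has degree 2, which is the only case in which a triangle and a quadrangle
  can share an edge.\<close>

definition share :: "'a \<Rightarrow> real" where
  "share v = (if v = x then 2 + 4 / deg v else 2 - 6 / deg v)"

definition weight :: "'a set \<Rightarrow> real" where "weight e = sum share e"

definition small :: "'i set" where "small = {\<phi> \<in> \<Phi>. card (fc \<phi>) \<le> 4}"

definition mult :: "'a set \<Rightarrow> nat" where "mult e = card {\<phi> \<in> small. e \<in> fc \<phi>}"

text \<open>What each small face at \<open>e\<close> receives from it. An edge on no small face has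
  \<open>mult e = 0\<close> and therefore part 0.\<close>

definition part :: "'a set \<Rightarrow> real" where "part e = weight e / mult e"

lemma edge_neq: "{u, v} \<in> E \<Longrightarrow> u \<noteq> v"
  using card_edge[of "{u, v}"] by auto

lemma finite_V: "finite (\<Union>E)"
  using finite_E card_edge by (metis card.infinite finite_Union zero_neq_numeral)

lemma share_x_ge: "2 \<le> share x"
  by (simp add: share_def)

text \<open>The values of \<open>2 - 6 / d\<close> are 0, 1/2, 4/5, 1, 8/7 for \<open>d\<close> = 3,
  4, 5, 6, 7, and \<open>x\<close> has share at least 2. So a vertex with small share has only
  neighbours with large share.\<close>

lemma share_cases:
  assumes "v \<in> \<Union>E"
  shows "4 / 5 \<le> share v \<or> share v = 1 / 2 \<and> (\<forall>u. {u, v} \<in> E \<longrightarrow> 1 \<le> share u) \<or>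
     share v = 0 \<and> (\<forall>u. {u, v} \<in> E \<longrightarrow> 8 / 7 \<le> share u)"
proof (cases "v = x")
  case True
  then show ?thesis using share_x_ge by auto
next
  case False
  have d: "3 \<le> deg v" using deg_ge3[OF assms False] by (simp add: deg_def)
  have ge: "2 - 6 / real n \<le> share u" if "n \<le> deg u" "0 < n" "u \<noteq> x" for n u
  proof -
    have "6 / real (deg u) \<le> 6 / real n" using that by (intro divide_left_mono) auto
    then show ?thesis using that by (simp add: share_def)
  qed
  consider "deg v = 3" | "deg v = 4" | "5 \<le> deg v" using d by linarith
  then show ?thesis
  proof cases
    case 1
    then have "share v = 0" using False by (simp add: share_def)
    moreover have "8 / 7 \<le> share u" if "{u, v} \<in> E" for u
    proof (cases "u = x")
      case True
      then show ?thesis using share_x_ge by simp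
    next
      case u: False
      then have "7 \<le> deg u" using deg3[OF that False u] 1 by (simp add: deg_def)
      then show ?thesis using ge[of 7 u] u by simp
    qed
    ultimately show ?thesis by blast
  next
    case 2
    then have "share v = 1 / 2" using False by (simp add: share_def)
    moreover have "1 \<le> share u" if "{u, v} \<in> E" for u
    proof (cases "u = x")
      case True
      then show ?thesis using share_x_ge by simp
    next
      case u: False
      then have "6 \<le> deg u" using deg4[OF that False u] 2 by (simp add: deg_def)
      then show ?thesis using ge[of 6 u] u by simp
    qed
    ultimately show ?thesis by blast
  next
    case 3
    then show ?thesis using ge[of 5 v] False by simp
  qed
qed

lemma share_nonneg: "v \<in> \<Union>E \<Longrightarrow> 0 \<le> share v"
  using share_cases[of v] by auto

lemma weight_edge: "{u, v} \<in> E \<Longrightarrow> weight {u, v} = share u + share v"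
  using edge_neq by (simp add: weight_def)

text \<open>The lower bounds from \<open>share_cases\<close> are 4/5 + 4/5, 1/2 + 1 and 0 +
  8/7.\<close>

lemma share_edge_ge1:
  assumes "{u, v} \<in> E"
  shows "1 \<le> share u + share v"
proof -
  have "u \<in> \<Union>E" "v \<in> \<Union>E" "{v, u} \<in> E" using assms by (auto simp: insert_commute)
  then show ?thesis
    using share_cases[of u] share_cases[of v] assms by (auto simp: insert_commute)
qed

lemma edgeE:
  assumes "e \<in> E" obtains u v where "e = {u, v}" "u \<noteq> v"
  using card_edge[OF assms] by (auto simp: card_2_iff)

lemma weight_ge1: "e \<in> E \<Longrightarrow> 1 \<le> weight e"
  using share_edge_ge1 weight_edge by (metis edgeE)

lemma mult_le2: "e \<in> E \<Longrightarrow> mult e \<le> 2"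
  unfolding mult_def small_def two_faces[of e, symmetric]
  by (rule card_mono) (auto intro: finite_subset[OF _ finite_\<Phi>])

lemma mult_pos: "\<phi> \<in> small \<Longrightarrow> e \<in> fc \<phi> \<Longrightarrow> 1 \<le> mult e"
  unfolding mult_def using finite_\<Phi>
  by (metis (mono_tags, lifting) One_nat_def Suc_leI card_gt_0_iff empty_iff finite_subset mem_Collect_eq small_def subsetI)

lemma part_ge_half:
  assumes "\<phi> \<in> small" "e \<in> fc \<phi>"
  shows "weight e / 2 \<le> part e"
proof -
  have e: "e \<in> E" using assms face_subset by (auto simp: small_def)
  have "mult e = 1 \<or> mult e = 2" using mult_le2[OF e] mult_pos[OF assms] by linarith
  then show ?thesis using weight_ge1[OF e] by (auto simp: part_def)
qed

lemma part_single:
  assumes "\<phi> \<in> small" "e \<in> fc \<phi>" "\<And>\<psi>. \<psi> \<in> small \<Longrightarrow> \<psi> \<noteq> \<phi> \<Longrightarrow> e \<notin> fc \<psi>"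
  shows "part e = weight e"
proof -
  have "{\<psi> \<in> small. e \<in> fc \<psi>} = {\<phi>}" using assms by blast
  then show ?thesis by (simp add: part_def mult_def)
qed

section \<open>Counting charge and faces\<close>

lemma sum_deg: "(\<Sum>v\<in>\<Union>E. f v * real (deg v)) = (\<Sum>e\<in>E. sum f e)" for f :: "'a \<Rightarrow> real"
proof -
  have "(\<Sum>v\<in>\<Union>E. f v * real (deg v)) = (\<Sum>v\<in>\<Union>E. \<Sum>e\<in>{e \<in> E. v \<in> e}. f v)"
    by (simp add: deg_def mult.commute)
  also have "\<dots> = (\<Sum>e\<in>E. \<Sum>v\<in>{v \<in> \<Union>E. v \<in> e}. f v)"
    by (rule sum.swap_restrict[OF finite_V finite_E])
  also have "\<dots> = (\<Sum>e\<in>E. sum f e)"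
    by (rule sum.cong) (auto intro!: arg_cong[where f = "sum f"])
  finally show ?thesis .
qed

lemma sum_weight: "(\<Sum>e\<in>E. weight e) = 4 * real (card E) - 6 * real (card (\<Union>E)) + 10"
proof -
  have "(\<Sum>v\<in>\<Union>E. (1::real) * real (deg v)) = (\<Sum>e\<in>E. 2)"
    unfolding sum_deg using card_edge by (intro sum.cong) auto
  then have hs: "(\<Sum>v\<in>\<Union>E. real (deg v)) = 2 * real (card E)" by simp
  \<comment> \<open>For \<open>x\<close> the product is \<open>2 * deg x + 4\<close>, which exceeds
    \<open>2 * deg x - 6\<close> by 10. Cancelling the degree requires it to be nonzero.\<close>
  have "share v * real (deg v) = 2 * real (deg v) - 6 + (if v = x then 10 else 0)" if "v \<in> \<Union>E" for v
  proof -
    have "{e \<in> E. v \<in> e} \<noteq> {}" using that by auto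
    then have "deg v \<noteq> 0" using finite_E by (simp add: deg_def)
    then show ?thesis by (cases "v = x") (simp_all add: share_def field_simps)
  qed
  then have "(\<Sum>v\<in>\<Union>E. share v * real (deg v)) = (\<Sum>v\<in>\<Union>E. 2 * real (deg v) - 6 + (if v = x then 10 else 0))"
    by (rule sum.cong[OF refl])
  also have "\<dots> = 2 * (\<Sum>v\<in>\<Union>E. real (deg v)) - 6 * real (card (\<Union>E)) + 10"
    using finite_V x by (simp add: sum.distrib sum_subtractf sum_distrib_left)
  finally show ?thesis using sum_deg[of share] hs by (simp add: weight_def)
qed

text \<open>After exchanging the sums, an edge on some small face hands out exactly its weight, and
  any other edge hands out nothing.\<close>

lemma sum_part_le: "(\<Sum>\<phi>\<in>small. \<Sum>e\<in>fc \<phi>. part e) \<le> (\<Sum>e\<in>E. weight e)"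
proof -
  have fin: "finite small" using finite_\<Phi> by (simp add: small_def)
  have "(\<Sum>\<phi>\<in>small. \<Sum>e\<in>fc \<phi>. part e) = (\<Sum>\<phi>\<in>small. \<Sum>e\<in>{e \<in> E. e \<in> fc \<phi>}. part e)"
    using face_subset by (intro sum.cong) (auto simp: small_def intro!: arg_cong[where f = "sum part"])
  also have "\<dots> = (\<Sum>e\<in>E. \<Sum>\<phi>\<in>{\<phi> \<in> small. e \<in> fc \<phi>}. part e)"
    by (rule sum.swap_restrict[OF fin finite_E])
  also have "\<dots> \<le> (\<Sum>e\<in>E. weight e)"
  proof (rule sum_mono)
    fix e assume "e \<in> E"
    then have "0 \<le> weight e" using weight_ge1[of e] by simp
    then show "(\<Sum>\<phi>\<in>{\<phi> \<in> small. e \<in> fc \<phi>}. part e) \<le> weight e"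
      by (simp add: part_def mult_def)
  qed
  finally show ?thesis .
qed

lemma sum_face_card: "(\<Sum>\<phi>\<in>\<Phi>. card (fc \<phi>)) = 2 * card E"
proof -
  have "(\<Sum>\<phi>\<in>\<Phi>. card (fc \<phi>)) = (\<Sum>\<phi>\<in>\<Phi>. \<Sum>e\<in>{e \<in> E. e \<in> fc \<phi>}. 1)"
    using face_subset by (intro sum.cong) (auto intro!: arg_cong[where f = card])
  also have "\<dots> = (\<Sum>e\<in>E. \<Sum>\<phi>\<in>{\<phi> \<in> \<Phi>. e \<in> fc \<phi>}. 1)"
    by (rule sum.swap_restrict[OF finite_\<Phi> finite_E])
  finally show ?thesis using two_faces by simp
qed

lemma face_card: "\<phi> \<in> \<Phi> \<Longrightarrow> card (fc \<phi>) = 3 \<or> card (fc \<phi>) = 4 \<or> 7 \<le> card (fc \<phi>)"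
  using is_cycle_card(2)[OF face_cycle, of \<phi>] no56[OF face_cycle face_subset, of \<phi>] by presburger

lemma discharging_contradiction:
  assumes "\<And>\<phi>. \<phi> \<in> \<Phi> \<Longrightarrow> card (fc \<phi>) = 3 \<Longrightarrow> 3 \<le> (\<Sum>e\<in>fc \<phi>. part e)"
    and "\<And>\<phi>. \<phi> \<in> \<Phi> \<Longrightarrow> card (fc \<phi>) = 4 \<Longrightarrow> 2 \<le> (\<Sum>e\<in>fc \<phi>. part e)"
  shows False
proof -
  have fin: "finite small" using finite_\<Phi> by (simp add: small_def)
  \<comment> \<open>The summand is 3 for a triangle and 2 for a quadrilateral.\<close>
  have "(\<Sum>\<phi>\<in>small. 9 - real (card (fc \<phi>)) * 2 + (if card (fc \<phi>) = 4 then 1 else 0)) \<le> (\<Sum>\<phi>\<in>small. \<Sum>e\<in>fc \<phi>. part e)"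
  proof (rule sum_mono)
    fix \<phi> assume "\<phi> \<in> small"
    then have "\<phi> \<in> \<Phi>" "card (fc \<phi>) = 3 \<or> card (fc \<phi>) = 4"
      using face_card[of \<phi>] by (auto simp: small_def)
    then show "9 - real (card (fc \<phi>)) * 2 + (if card (fc \<phi>) = 4 then 1 else 0) \<le> (\<Sum>e\<in>fc \<phi>. part e)"
      using assms by auto
  qed
  also have "\<dots> \<le> 4 * real (card E) - 6 * real (card (\<Union>E)) + 10"
    using sum_part_le sum_weight by simp
  finally have upper: "(\<Sum>\<phi>\<in>small. 9 - real (card (fc \<phi>)) * 2 + (if card (fc \<phi>) = 4 then 1 else 0)) \<le>
    4 * real (card E) - 6 * real (card (\<Union>E)) + 10" .
  \<comment> \<open>There is equality for lengths 3 and 4, and \<open>6 - 7 < 0\<close> settles the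
    longer faces. The left side equals \<open>6 * card \<Phi> - 2 * card E\<close>, to which Euler's
    formula applies.\<close>
  have "(\<Sum>\<phi>\<in>\<Phi>. 6 - real (card (fc \<phi>))) \<le>
      (\<Sum>\<phi>\<in>\<Phi>. if \<phi> \<in> small then 9 - real (card (fc \<phi>)) * 2 + (if card (fc \<phi>) = 4 then 1 else 0) else 0)"
    using face_card by (intro sum_mono) (force simp: small_def)
  also have "\<dots> = (\<Sum>\<phi>\<in>small. 9 - real (card (fc \<phi>)) * 2 + (if card (fc \<phi>) = 4 then 1 else 0))"
    using finite_\<Phi> by (subst sum.inter_filter[symmetric]) (auto simp: small_def intro!: sum.cong)
  finally have "6 * real (card \<Phi>) - 2 * real (card E) \<le> \<dots>"
    using sum_face_card by (simp add: sum_subtractf flip: of_nat_sum)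
  then have "6 * real (card \<Phi>) - 2 * real (card E) \<le> 4 * real (card E) - 6 * real (card (\<Union>E)) + 10"
    using upper by linarith
  moreover have "real (card E) + 2 = real (card \<Phi>) + real (card (\<Union>E))"
    using euler by (metis of_nat_add of_nat_numeral)
  ultimately show False by linarith
qed

text \<open>Each of the four edges has weight at least 1 and splits it between at most two
  faces.\<close>

lemma four_face_parts:
  assumes "\<phi> \<in> \<Phi>" "card (fc \<phi>) = 4"
  shows "2 \<le> (\<Sum>e\<in>fc \<phi>. part e)"
proof -
  have s: "\<phi> \<in> small" using assms by (simp add: small_def)
  have "1 / 2 \<le> part e" if "e \<in> fc \<phi>" for e
    using part_ge_half[OF s that] weight_ge1[of e] face_subset[OF assms(1)] that by force
  then have "(\<Sum>e\<in>fc \<phi>. 1 / 2) \<le> (\<Sum>e\<in>fc \<phi>. part e)" by (intro sum_mono)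
  then show ?thesis using assms(2) by simp
qed

section \<open>How small faces can be adjacent\<close>

lemma star_closed:
  assumes "v \<in> \<Union>E" "S \<subseteq> {e \<in> E. v \<in> e}" "S \<noteq> {}"
    and "\<And>\<phi>. \<phi> \<in> \<Phi> \<Longrightarrow> S \<inter> fc \<phi> \<noteq> {} \<Longrightarrow> even (card (S \<inter> fc \<phi>))"
  shows "S = {e \<in> E. v \<in> e}"
  using parity[OF assms(1,2)] assms(3,4) by (metis card.empty dvd_0_right)

lemma two_facesD:
  assumes "e \<in> E" "\<phi> \<in> \<Phi>" "\<psi> \<in> \<Phi>" "\<phi> \<noteq> \<psi>" "e \<in> fc \<phi>" "e \<in> fc \<psi>" "\<eta> \<in> \<Phi>" "e \<in> fc \<eta>"
  shows "\<eta> = \<phi> \<or> \<eta> = \<psi>"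
proof -
  have fin: "finite {\<phi> \<in> \<Phi>. e \<in> fc \<phi>}" using finite_\<Phi> by simp
  have "{\<phi>, \<psi>} \<subseteq> {\<phi> \<in> \<Phi>. e \<in> fc \<phi>}" using assms by simp
  then have "{\<phi>, \<psi>} = {\<phi> \<in> \<Phi>. e \<in> fc \<phi>}"
    using two_faces[OF assms(1)] assms(4) by (intro card_subset_eq[OF fin]) auto
  then show ?thesis using assms(7,8) by blast
qed

text \<open>The two edges at \<open>v\<close> have no faces besides \<phi> and \<psi>, and each of
  these contains both. So the two edges form an even set and hence the whole star of
  \<open>v\<close>, and only \<open>x\<close> can have degree 2.\<close>

lemma common_corner:
  assumes "\<phi> \<in> \<Phi>" "\<psi> \<in> \<Phi>" "\<phi> \<noteq> \<psi>" "u \<noteq> w"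
    and "{u, v} \<in> fc \<phi>" "{v, w} \<in> fc \<phi>" "{u, v} \<in> fc \<psi>" "{v, w} \<in> fc \<psi>"
  shows "v = x" "deg v = 2"
proof -
  let ?S = "{{u, v}, {v, w}}"
  have E: "{u, v} \<in> E" "{v, w} \<in> E" using assms face_subset by blast+
  have "{u, v} \<noteq> {v, w}" using assms(4) by (auto simp: doubleton_eq_iff)
  then have c: "card ?S = 2" by simp
  have "even (card (?S \<inter> fc \<eta>))" if \<eta>: "\<eta> \<in> \<Phi>" "?S \<inter> fc \<eta> \<noteq> {}" for \<eta>
  proof -
    have "\<eta> = \<phi> \<or> \<eta> = \<psi>"
      using \<eta> two_facesD[OF E(1) assms(1-3,5,7) \<eta>(1)] two_facesD[OF E(2) assms(1-3,6,8) \<eta>(1)] by blast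
    then have "?S \<inter> fc \<eta> = ?S" using assms by blast
    then show ?thesis using c by simp
  qed
  then have S: "?S = {e \<in> E. v \<in> e}" using E by (intro star_closed) auto
  then show "deg v = 2" using c by (simp add: deg_def)
  then show "v = x" using deg_ge3[of v] E by (fastforce simp: deg_def)
qed

lemma no_5_cycle:
  assumes "distinct [a, b, c, d, e]" "{a, b} \<in> E" "{b, c} \<in> E" "{c, d} \<in> E" "{d, e} \<in> E" "{e, a} \<in> E"
  shows False
  using is_cycle_card5I[OF assms(1)] no56 assms(2-) by (metis empty_subsetI insert_subset)

text \<open>If the third vertices coincided, \<open>u\<close> and \<open>v\<close> would both be
  common corners, hence both equal to \<open>x\<close>.\<close>

lemma triangles_share_one_edge:
  assumes "\<phi> \<in> \<Phi>" "\<psi> \<in> \<Phi>" "\<phi> \<noteq> \<psi>" "distinct [u, v, w]" "fc \<phi> = {{u, v}, {v, w}, {w, u}}"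
    and "card (fc \<psi>) = 3" "{u, v} \<in> fc \<psi>"
  obtains a where "distinct [u, v, w, a]" "fc \<psi> = {{u, v}, {v, a}, {a, u}}"
proof -
  obtain a where a: "distinct [u, v, a]" "fc \<psi> = {{u, v}, {v, a}, {a, u}}"
    using is_cycle_card3E[OF face_cycle[OF assms(2)] assms(6,7)] assms(4) by auto
  have "a \<noteq> w"
  proof
    assume "a = w"
    then have "u = x" "v = x"
      using common_corner(1)[OF assms(1-3), of u w v] common_corner(1)[OF assms(1-3), of v w u]
        assms(4,5) a by (auto simp: insert_commute)
    then show False using assms(4) by simp
  qed
  then show thesis using that[of a] a assms(4) by auto
qed

text \<open>If the third vertices \<open>a\<close> and \<open>b\<close> of the neighbouring
  triangles differed, then \<open>a\<close>, \<open>u\<close>, \<open>w\<close>, \<open>b\<close>,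
  \<open>v\<close> would form a 5-cycle. So \<open>a = b\<close>, and the three triangles close up
  around \<open>v\<close>: its edges to \<open>u\<close>, \<open>w\<close> and \<open>a\<close> form
  an even set.\<close>

lemma two_adjacent_triangles:
  assumes \<phi>: "\<phi> \<in> \<Phi>" "distinct [u, v, w]" "fc \<phi> = {{u, v}, {v, w}, {w, u}}"
    and \<psi>: "\<psi> \<in> \<Phi>" "\<psi> \<noteq> \<phi>" "card (fc \<psi>) = 3" "{u, v} \<in> fc \<psi>"
    and \<eta>: "\<eta> \<in> \<Phi>" "\<eta> \<noteq> \<phi>" "card (fc \<eta>) = 3" "{v, w} \<in> fc \<eta>"
  shows "deg v = 3"
proof -
  obtain a where a: "distinct [u, v, w, a]" "fc \<psi> = {{u, v}, {v, a}, {a, u}}"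
    using triangles_share_one_edge[OF \<phi>(1) \<psi>(1) \<psi>(2)[symmetric] \<phi>(2,3) \<psi>(3,4)] by metis
  have "distinct [v, w, u]" "fc \<phi> = {{v, w}, {w, u}, {u, v}}" using \<phi>(2,3) by auto
  then obtain b where b: "distinct [v, w, u, b]" "fc \<eta> = {{v, w}, {w, b}, {b, v}}"
    using triangles_share_one_edge[OF \<phi>(1) \<eta>(1) \<eta>(2)[symmetric] _ _ \<eta>(3,4)] by metis
  have E: "fc \<phi> \<subseteq> E" "fc \<psi> \<subseteq> E" "fc \<eta> \<subseteq> E" using face_subset \<phi> \<psi> \<eta> by auto
  have "a = b"
  proof (rule ccontr)
    assume "a \<noteq> b"
    then have "distinct [a, u, w, b, v]" using a b by auto
    then show False by (rule no_5_cycle) (use a b \<phi>(3) E in \<open>auto simp: insert_commute\<close>)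
  qed
  have \<eta>': "fc \<eta> = {{v, w}, {w, a}, {a, v}}" using b \<open>a = b\<close> by simp
  have mem: "{u, v} \<in> fc \<phi>" "{v, w} \<in> fc \<phi>" "{u, v} \<in> fc \<psi>" "{v, a} \<in> fc \<psi>" "{v, w} \<in> fc \<eta>" "{v, a} \<in> fc \<eta>"
    unfolding \<phi>(3) a(2) \<eta>' by (simp_all add: insert_commute)
  have nmem: "{v, a} \<notin> fc \<phi>" "{v, w} \<notin> fc \<psi>" "{u, v} \<notin> fc \<eta>"
    unfolding \<phi>(3) a(2) \<eta>' using a(1) by (auto simp: doubleton_eq_iff)
  have "\<psi> \<noteq> \<eta>" using mem nmem by metis
  have ne: "{u, v} \<noteq> {v, w}" "{u, v} \<noteq> {v, a}" "{v, w} \<noteq> {v, a}"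
    using a(1) by (auto simp: doubleton_eq_iff)
  let ?S = "{{u, v}, {v, w}, {v, a}}"
  have S\<phi>: "?S \<inter> fc \<phi> = {{u, v}, {v, w}}" and S\<psi>: "?S \<inter> fc \<psi> = {{u, v}, {v, a}}"
    and S\<eta>: "?S \<inter> fc \<eta> = {{v, w}, {v, a}}"
    using mem nmem by simp_all
  have "even (card (?S \<inter> fc \<xi>))" if \<xi>: "\<xi> \<in> \<Phi>" "?S \<inter> fc \<xi> \<noteq> {}" for \<xi>
  proof -
    have "\<xi> = \<phi> \<or> \<xi> = \<psi> \<or> \<xi> = \<eta>"
      using \<xi> two_facesD[OF _ \<phi>(1) \<psi>(1) \<psi>(2)[symmetric] mem(1,3) \<xi>(1)]
        two_facesD[OF _ \<phi>(1) \<eta>(1) \<eta>(2)[symmetric] mem(2,5) \<xi>(1)]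
        two_facesD[OF _ \<psi>(1) \<eta>(1) \<open>\<psi> \<noteq> \<eta>\<close> mem(4,6) \<xi>(1)] E mem by blast
    then show ?thesis using S\<phi> S\<psi> S\<eta> ne by (elim disjE) simp_all
  qed
  moreover have "?S \<subseteq> {e \<in> E. v \<in> e}" using mem E by auto
  moreover have "v \<in> \<Union>E" using E \<phi>(3) by auto
  ultimately have "?S = {e \<in> E. v \<in> e}" by (intro star_closed) auto
  moreover have "card ?S = 3" using ne by simp
  ultimately show ?thesis by (simp add: deg_def)
qed

definition shared :: "'i \<Rightarrow> 'a set \<Rightarrow> bool" where
  "shared \<phi> e \<longleftrightarrow> (\<exists>\<psi>\<in>\<Phi>. \<psi> \<noteq> \<phi> \<and> card (fc \<psi>) = 3 \<and> e \<in> fc \<psi>)"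

lemma triangle_two_shared:
  assumes \<phi>: "\<phi> \<in> \<Phi>" "distinct [u, v, w]" "fc \<phi> = {{u, v}, {v, w}, {w, u}}"
    and sh: "shared \<phi> {u, v}" "shared \<phi> {v, w}"
  shows "deg v = 3"
  using two_adjacent_triangles[OF \<phi>] sh unfolding shared_def by metis

text \<open>All three corners would have degree 3. Two of them differ from \<open>x\<close>, and
  adjacent 3-vertices contradict \<open>deg3\<close>.\<close>

lemma triangle_not_all_shared:
  assumes \<phi>: "\<phi> \<in> \<Phi>" "distinct [u, v, w]" "fc \<phi> = {{u, v}, {v, w}, {w, u}}"
    and sh: "shared \<phi> {u, v}" "shared \<phi> {v, w}" "shared \<phi> {w, u}"
  shows False
proof -
  have r: "distinct [v, w, u]" "fc \<phi> = {{v, w}, {w, u}, {u, v}}"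
    "distinct [w, u, v]" "fc \<phi> = {{w, u}, {u, v}, {v, w}}" using \<phi> by auto
  have d: "deg u = 3" "deg v = 3" "deg w = 3"
    using triangle_two_shared[OF \<phi> sh(1,2)] triangle_two_shared[OF \<phi>(1) r(1,2) sh(2,3)]
      triangle_two_shared[OF \<phi>(1) r(3,4) sh(3,1)] by auto
  have E: "{u, v} \<in> E" "{v, w} \<in> E" "{w, u} \<in> E" using face_subset[OF \<phi>(1)] \<phi>(3) by auto
  have no: False if "{p, q} \<in> E" "p \<noteq> x" "q \<noteq> x" "deg p = 3" "deg q = 3" for p q
    using deg3[OF that(1,3,2)] that(4,5) by (simp add: deg_def)
  show False
  proof (cases "u = x")
    case True
    then have "v \<noteq> x" "w \<noteq> x" using \<phi>(2) by auto
    then show False using no[OF E(2)] d by blast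
  next
    case u: False
    show False
    proof (cases "v = x")
      case True
      then have "w \<noteq> x" using \<phi>(2) by auto
      then show False using no[OF E(3)] d u by blast
    next
      case False
      then show False using no[OF E(1)] d u by blast
    qed
  qed
qed

text \<open>The third vertex of the triangle lies on the quadrilateral, as otherwise the common edge
  could be replaced by the other two sides of the triangle to give a 5-cycle. So the two faces have
  a common corner, which is \<open>x\<close>.\<close>

lemma triangle_quadrilateral_corner:
  assumes \<phi>: "\<phi> \<in> \<Phi>" "card (fc \<phi>) = 3" and \<psi>: "\<psi> \<in> \<Phi>" "card (fc \<psi>) = 4"
    and e: "e \<in> fc \<phi>" "e \<in> fc \<psi>"
  obtains e1 e2 where "e1 \<noteq> e2" "e1 \<in> fc \<phi>" "e2 \<in> fc \<phi>" "x \<in> e1" "x \<in> e2" "deg x = 2"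
proof -
  have ne: "\<phi> \<noteq> \<psi>" using \<phi> \<psi> by auto
  have "e \<in> E" using e face_subset \<phi> by blast
  then obtain u v where uv: "e = {u, v}" "u \<noteq> v" by (rule edgeE)
  obtain w where w: "distinct [u, v, w]" "fc \<phi> = {{u, v}, {v, w}, {w, u}}"
    using is_cycle_card3E[OF face_cycle[OF \<phi>(1)] \<phi>(2)] e(1) uv by metis
  obtain y z where yz: "distinct [u, v, y, z]" "fc \<psi> = {{u, v}, {v, y}, {y, z}, {z, u}}"
    using is_cycle_card4E[OF face_cycle[OF \<psi>(1)] \<psi>(2)] e(2) uv by metis
  have E: "{u, v} \<in> E" "{v, w} \<in> E" "{w, u} \<in> E" "{v, y} \<in> E" "{y, z} \<in> E" "{z, u} \<in> E"
    using face_subset[OF \<phi>(1)] face_subset[OF \<psi>(1)] w(2) yz(2) by auto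
  consider "w = y" | "w = z" | "w \<noteq> y" "w \<noteq> z" by blast
  then show thesis
  proof cases
    case 1
    have "{u, v} \<in> fc \<phi>" "{v, w} \<in> fc \<phi>" "{u, v} \<in> fc \<psi>" "{v, w} \<in> fc \<psi>"
      unfolding w(2) yz(2) using 1 by simp_all
    then have "v = x" "deg v = 2" using common_corner[OF \<phi>(1) \<psi>(1) ne, of u w v] w(1) by auto
    moreover have "{u, v} \<noteq> {v, w}" using w(1) by (auto simp: doubleton_eq_iff)
    ultimately show thesis using that[of "{u, v}" "{v, w}"] w(2) by simp
  next
    case 2
    have "{v, u} \<in> fc \<phi>" "{u, w} \<in> fc \<phi>" "{v, u} \<in> fc \<psi>" "{u, w} \<in> fc \<psi>"
      unfolding w(2) yz(2) using 2 by (simp_all add: insert_commute)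
    then have "u = x" "deg u = 2" using common_corner[OF \<phi>(1) \<psi>(1) ne, of v w u] w(1) by auto
    moreover have "{u, v} \<noteq> {w, u}" using w(1) by (auto simp: doubleton_eq_iff)
    ultimately show thesis using that[of "{u, v}" "{w, u}"] w(2) by simp
  next
    case 3
    then have "distinct [u, w, v, y, z]" using w(1) yz(1) by auto
    then have False by (rule no_5_cycle) (use E in \<open>simp_all add: insert_commute\<close>)
    then show thesis ..
  qed
qed

section \<open>Charge received by triangles\<close>

lemma triangle_parts_one:
  assumes \<phi>: "\<phi> \<in> \<Phi>" "distinct [u, v, w]" "fc \<phi> = {{u, v}, {v, w}, {w, u}}"
    and nQ: "\<forall>\<psi>\<in>\<Phi>. card (fc \<psi>) = 4 \<longrightarrow> fc \<phi> \<inter> fc \<psi> = {}"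
    and sh: "\<not> shared \<phi> {v, w}" "\<not> shared \<phi> {w, u}"
  shows "3 \<le> part {u, v} + part {v, w} + part {w, u}"
proof -
  have c3: "card (fc \<phi>) = 3" using card_triangle[OF \<phi>(2)] by (simp add: \<phi>(3))
  then have s: "\<phi> \<in> small" using \<phi>(1) by (simp add: small_def)
  have E: "{u, v} \<in> E" "{v, w} \<in> E" "{w, u} \<in> E" "{v, u} \<in> E" "{w, v} \<in> E" "{u, w} \<in> E"
    using face_subset[OF \<phi>(1)] \<phi>(3) by (auto simp: insert_commute)
  have single: "part e = weight e" if "e \<in> fc \<phi>" "\<not> shared \<phi> e" for e
    using s that(1)
  proof (rule part_single)
    fix \<psi> assume "\<psi> \<in> small" "\<psi> \<noteq> \<phi>"
    then show "e \<notin> fc \<psi>" using that nQ face_card[of \<psi>] unfolding shared_def small_def by auto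
  qed
  have "part {v, w} = share v + share w" "part {w, u} = share w + share u"
    using single sh \<phi>(3) weight_edge E by auto
  moreover have "(share u + share v) / 2 \<le> part {u, v}"
    using part_ge_half[OF s, of "{u, v}"] \<phi>(3) weight_edge[OF E(1)] by auto
  \<comment> \<open>Twice the required bound: \<open>{u, v}\<close> gives at least half of its
    weight, the other two edges all of it. The least value allowed by \<open>share_cases\<close> is
    48/7, for \<open>share w = 0\<close>.\<close>
  moreover have "6 \<le> 3 * share u + 3 * share v + 4 * share w"
  proof -
    have V: "u \<in> \<Union>E" "v \<in> \<Union>E" "w \<in> \<Union>E" using E by auto
    have cases: "4 / 5 \<le> share p \<or> share p = 1 / 2 \<and> 1 \<le> share q \<and> 1 \<le> share r \<or>
        share p = 0 \<and> 8 / 7 \<le> share q \<and> 8 / 7 \<le> share r"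
      if "p \<in> \<Union>E" "{q, p} \<in> E" "{r, p} \<in> E" for p q r
      using share_cases[OF that(1)] that(2,3) by blast
    from cases[OF V(1) E(4,3)] cases[OF V(2) E(1,5)] cases[OF V(3) E(2,6)]
    show ?thesis by (elim disjE conjE) linarith+
  qed
  ultimately show ?thesis by (simp add: field_simps)
qed

lemma triangle_parts_two:
  assumes \<phi>: "\<phi> \<in> \<Phi>" "distinct [u, v, w]" "fc \<phi> = {{u, v}, {v, w}, {w, u}}"
    and nQ: "\<forall>\<psi>\<in>\<Phi>. card (fc \<psi>) = 4 \<longrightarrow> fc \<phi> \<inter> fc \<psi> = {}"
    and sh: "shared \<phi> {u, v}" "shared \<phi> {v, w}" "\<not> shared \<phi> {w, u}"
  shows "3 \<le> part {u, v} + part {v, w} + part {w, u}"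
proof -
  have c3: "card (fc \<phi>) = 3" using card_triangle[OF \<phi>(2)] by (simp add: \<phi>(3))
  then have s: "\<phi> \<in> small" using \<phi>(1) by (simp add: small_def)
  have E: "{u, v} \<in> E" "{v, w} \<in> E" "{w, u} \<in> E" "{w, v} \<in> E"
    using face_subset[OF \<phi>(1)] \<phi>(3) by (auto simp: insert_commute)
  have "part {w, u} = weight {w, u}"
    using s
  proof (rule part_single)
    show "{w, u} \<in> fc \<phi>" using \<phi>(3) by simp
    fix \<psi> assume "\<psi> \<in> small" "\<psi> \<noteq> \<phi>"
    then show "{w, u} \<notin> fc \<psi>"
      using sh(3) nQ \<phi>(3) face_card[of \<psi>] unfolding shared_def small_def by auto
  qed
  moreover have "weight e / 2 \<le> part e" if "e \<in> fc \<phi>" for e using part_ge_half[OF s that] .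
  then have "weight {u, v} / 2 \<le> part {u, v}" "weight {v, w} / 2 \<le> part {v, w}" using \<phi>(3) by auto
  \<comment> \<open>Again twice the required bound, now with half of the weight from the two shared
    edges. If \<open>v\<close> is not \<open>x\<close>, it has degree 3, so \<open>u\<close> and
    \<open>w\<close> have share at least 8/7.\<close>
  moreover have "6 \<le> 3 * share u + 3 * share w + 2 * share v"
  proof (cases "v = x")
    case True
    then show ?thesis using share_x_ge share_edge_ge1[OF E(3)] by simp
  next
    case False
    have "deg v = 3" by (rule triangle_two_shared[OF \<phi> sh(1,2)])
    then have v0: "share v = 0" using False by (simp add: share_def)
    have v: "v \<in> \<Union>E" using E by auto
    have "8 / 7 \<le> share q" if "{q, v} \<in> E" for q
      using share_cases[OF v] that v0 by auto
    then have "8 / 7 \<le> share u" "8 / 7 \<le> share w" using E by blast+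
    then show ?thesis using v0 by linarith
  qed
  ultimately show ?thesis using weight_edge E by (simp add: field_simps)
qed

text \<open>Next to a quadrilateral the triangle has \<open>x\<close> as a corner of degree 2 and
  share 4, and the two edges at \<open>x\<close> give at least 2 each. Otherwise the number of edges
  shared with triangles decides.\<close>

lemma triangle_parts:
  assumes \<phi>: "\<phi> \<in> \<Phi>" "card (fc \<phi>) = 3"
  shows "3 \<le> (\<Sum>e\<in>fc \<phi>. part e)"
proof -
  have s: "\<phi> \<in> small" using \<phi> by (simp add: small_def)
  have fin: "finite (fc \<phi>)" using \<phi>(2) by (metis card.infinite zero_neq_numeral)
  have sub: "fc \<phi> \<subseteq> E" using face_subset \<phi>(1) .
  show ?thesis
  proof (cases "\<exists>\<psi>\<in>\<Phi>. card (fc \<psi>) = 4 \<and> fc \<phi> \<inter> fc \<psi> \<noteq> {}")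
    case True
    then obtain \<psi> e where "\<psi> \<in> \<Phi>" "card (fc \<psi>) = 4" "e \<in> fc \<phi>" "e \<in> fc \<psi>" by blast
    then obtain e1 e2 where e: "e1 \<noteq> e2" "e1 \<in> fc \<phi>" "e2 \<in> fc \<phi>" "x \<in> e1" "x \<in> e2" "deg x = 2"
      using triangle_quadrilateral_corner[OF \<phi>] by metis
    have "share x = 4" using e(6) by (simp add: share_def)
    have "2 \<le> part f" if f: "f \<in> fc \<phi>" "x \<in> f" for f
    proof -
      have "f \<in> E" using f sub by blast
      then obtain y where y: "f = {x, y}" using edgeE f(2) by (metis doubleton_eq_iff insert_iff singletonD)
      then have "4 \<le> weight f"
        using weight_edge[of x y] share_nonneg[of y] \<open>share x = 4\<close> \<open>f \<in> E\<close> by auto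
      then show ?thesis using part_ge_half[OF s f(1)] by simp
    qed
    then have "2 \<le> part e1" "2 \<le> part e2" using e by blast+
    then have "4 \<le> part e1 + part e2" by simp
    also have "\<dots> = (\<Sum>e\<in>{e1, e2}. part e)" using e(1) by simp
    also have "\<dots> \<le> (\<Sum>e\<in>fc \<phi>. part e)"
    proof (rule sum_mono2[OF fin])
      show "{e1, e2} \<subseteq> fc \<phi>" using e by simp
      fix f assume "f \<in> fc \<phi> - {e1, e2}"
      then show "0 \<le> part f" using part_ge_half[OF s, of f] weight_ge1[of f] sub by force
    qed
    finally show ?thesis by simp
  next
    case False
    then have nQ: "\<forall>\<psi>\<in>\<Phi>. card (fc \<psi>) = 4 \<longrightarrow> fc \<phi> \<inter> fc \<psi> = {}" by blast
    obtain e where e: "e \<in> fc \<phi>" using \<phi>(2) by fastforce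
    then obtain u v where uv: "e = {u, v}" "u \<noteq> v" using edgeE sub by blast
    obtain w where w: "distinct [u, v, w]" "fc \<phi> = {{u, v}, {v, w}, {w, u}}"
      using is_cycle_card3E[OF face_cycle[OF \<phi>(1)] \<phi>(2)] e uv by metis
    have r: "distinct [v, w, u]" "fc \<phi> = {{v, w}, {w, u}, {u, v}}"
      "distinct [w, u, v]" "fc \<phi> = {{w, u}, {u, v}, {v, w}}" using w by auto
    have "{u, v} \<noteq> {v, w}" "{u, v} \<noteq> {w, u}" "{v, w} \<noteq> {w, u}"
      using w(1) by (auto simp: doubleton_eq_iff)
    then have "(\<Sum>e\<in>fc \<phi>. part e) = part {u, v} + part {v, w} + part {w, u}"
      unfolding w(2) by simp
    \<comment> \<open>The three rotations of the triangle cover every choice of the shared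
      edges.\<close>
    moreover note triangle_not_all_shared[OF \<phi>(1) w]
      triangle_parts_one[OF \<phi>(1) w nQ] triangle_parts_two[OF \<phi>(1) w nQ]
      triangle_parts_one[OF \<phi>(1) r(1,2) nQ] triangle_parts_two[OF \<phi>(1) r(1,2) nQ]
      triangle_parts_one[OF \<phi>(1) r(3,4) nQ] triangle_parts_two[OF \<phi>(1) r(3,4) nQ]
    ultimately show ?thesis by argo
  qed
qed

theorem discharging_False: False
  using discharging_contradiction triangle_parts four_face_parts by blast

end

section \<open>Total graphs and light edges\<close>

text \<open>Each entry is tested against the tail, so the list is the vertex ordering read backwards
  and its head is the last vertex.\<close>

primrec degenerate_list :: "'b set set \<Rightarrow> nat \<Rightarrow> 'b list \<Rightarrow> bool" where
  "degenerate_list A m [] \<longleftrightarrow> True"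
| "degenerate_list A m (y # ys) \<longleftrightarrow> y \<notin> set ys \<and> card {z \<in> set ys. {z, y} \<in> A} < m \<and> degenerate_list A m ys"

lemma degenerate_list_distinct: "degenerate_list A m ys \<Longrightarrow> distinct ys"
  by (induction ys) auto

lemma degenerate_list_empty: "distinct ys \<Longrightarrow> 0 < m \<Longrightarrow> degenerate_list {} m ys"
  by (induction ys) auto

lemma degenerate_list_filter:
  assumes "degenerate_list A m ys" "\<And>a b. P a \<Longrightarrow> P b \<Longrightarrow> {a, b} \<in> B \<Longrightarrow> {a, b} \<in> A"
  shows "degenerate_list B m (filter P ys)"
  using assms(1)
proof (induction ys)
  case (Cons y ys)
  have "card {z \<in> set (filter P ys). {z, y} \<in> B} < m" if "P y"
  proof -
    have "card {z \<in> set (filter P ys). {z, y} \<in> B} \<le> card {z \<in> set ys. {z, y} \<in> A}"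
      using assms(2) that by (intro card_mono) auto
    then show ?thesis using Cons.prems by simp
  qed
  then show ?case using Cons by simp
qed simp

lemma degenerate_list_rev_nth:
  assumes "degenerate_list A m ys" "i < length ys"
  shows "card {j. j < i \<and> {rev ys ! j, rev ys ! i} \<in> A} < m"
  using assms
proof (induction ys)
  case (Cons y ys)
  show ?case
  proof (cases "i < length ys")
    case True
    then have "{j. j < i \<and> {rev (y # ys) ! j, rev (y # ys) ! i} \<in> A} = {j. j < i \<and> {rev ys ! j, rev ys ! i} \<in> A}"
      by (auto simp: nth_append)
    then show ?thesis using Cons True by simp
  next
    case False
    then have i: "i = length ys" using Cons.prems by simp
    let ?J = "{j. j < i \<and> {rev (y # ys) ! j, rev (y # ys) ! i} \<in> A}"
    have "inj_on (\<lambda>j. rev ys ! j) ?J"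
      using degenerate_list_distinct Cons.prems(1) i by (auto intro!: inj_on_nth)
    moreover have "(\<lambda>j. rev ys ! j) ` ?J \<subseteq> {z \<in> set ys. {z, y} \<in> A}"
      using i by (auto simp: nth_append) (metis length_rev nth_mem set_rev)
    ultimately have "card ?J \<le> card {z \<in> set ys. {z, y} \<in> A}"
      by (intro card_inj_on_le) auto
    then show ?thesis using Cons.prems by simp
  qed
qed simp

lemma coloring_number_le:
  assumes "degenerate_list (edges H) m ys" "set ys = verts H"
  shows "coloring_number H \<le> m"
  unfolding coloring_number_def
proof (rule Least_le, intro exI conjI allI impI)
  show "distinct (rev ys)" using degenerate_list_distinct[OF assms(1)] by simp
  show "set (rev ys) = verts H" using assms(2) by simp
  show "card {j. j < i \<and> {rev ys ! j, rev ys ! i} \<in> edges H} < m" if "i < length (rev ys)" for i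
    using degenerate_list_rev_nth[OF assms(1)] that by simp
qed

section \<open>Adding a light edge to the total graph\<close>

lemma finite_edges: "finite_simple_graph G \<Longrightarrow> finite (edges G)"
  unfolding finite_simple_graph_def by (meson Pow_iff finite_Pow_iff finite_subset subsetI)

lemma card_neighbours_le:
  assumes "finite_simple_graph G"
  shows "finite {w. {u, w} \<in> edges G}" "card {w. {u, w} \<in> edges G} \<le> degree G u"
proof -
  have fin: "finite {e \<in> edges G. u \<in> e}" using finite_edges[OF assms] by simp
  have inj: "inj_on (\<lambda>w. {u, w}) {w. {u, w} \<in> edges G}" by (auto simp: inj_on_def doubleton_eq_iff)
  have sub: "(\<lambda>w. {u, w}) ` {w. {u, w} \<in> edges G} \<subseteq> {e \<in> edges G. u \<in> e}" by auto
  show "finite {w. {u, w} \<in> edges G}" using inj_on_finite[OF inj sub fin] .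
  show "card {w. {u, w} \<in> edges G} \<le> degree G u"
    unfolding degree_def by (rule card_inj_on_le[OF inj sub fin])
qed

lemma total_graph_edge_simps:
  "{Inl a, Inl b} \<in> edges (total_graph G) \<longleftrightarrow> {a, b} \<in> edges G"
  "{Inr e, Inr f} \<in> edges (total_graph G) \<longleftrightarrow> e \<in> edges G \<and> f \<in> edges G \<and> e \<noteq> f \<and> e \<inter> f \<noteq> {}"
  "{Inl a, Inr e} \<in> edges (total_graph G) \<longleftrightarrow> e \<in> edges G \<and> a \<in> e"
  "{Inr e, Inl a} \<in> edges (total_graph G) \<longleftrightarrow> e \<in> edges G \<and> a \<in> e"
  unfolding total_graph_def by (auto simp: doubleton_eq_iff insert_commute)

lemma degenerate_list_add_light_edge:
  assumes G: "finite_simple_graph G" and e: "{u, v} \<in> edges G"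
    and light: "2 * degree G u \<le> k + 1" "degree G u + degree G v \<le> k + 2"
    and ys: "degenerate_list (edges (total_graph (G\<lparr>edges := edges G - {{u, v}}\<rparr>))) (k + 2) ys"
      "set ys = verts (total_graph (G\<lparr>edges := edges G - {{u, v}}\<rparr>))"
  shows "\<exists>zs. degenerate_list (edges (total_graph G)) (k + 2) zs \<and> set zs = verts (total_graph G)"
proof -
  let ?e = "{u, v}" and ?T = "edges (total_graph G)"
  let ?zs = "filter (\<lambda>z. z \<noteq> Inl u) ys"
  have V: "set ys = verts G <+> (edges G - {?e})" using ys(2) by (simp add: total_graph_def)
  have "{u, v} \<subseteq> verts G" using G e unfolding finite_simple_graph_def by blast
  then have uv: "u \<in> verts G" "v \<in> verts G" by simp_all
  define P where "P z \<longleftrightarrow> z \<noteq> Inl u \<and> z \<noteq> Inr ?e" for z :: "'a + 'a set"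
  have "Inr ?e \<notin> set ys" unfolding V by auto
  then have "z \<noteq> Inl u \<longleftrightarrow> P z" if "z \<in> set ys" for z using that unfolding P_def by metis
  then have "?zs = filter P ys" by (rule filter_cong[OF refl])
  \<comment> \<open>Without \<open>u\<close> and the edge \<open>{u, v}\<close> the two total graphs
    agree, as two vertices other than \<open>u\<close> never form the deleted edge.\<close>
  moreover have "degenerate_list ?T (k + 2) (filter P ys)"
  proof (rule degenerate_list_filter[OF ys(1)])
    fix a b assume ab: "P a" "P b" "{a, b} \<in> ?T"
    have "u \<in> ?e" by simp
    then have "{p, q} \<noteq> ?e" if "p \<noteq> u" "q \<noteq> u" for p q using that by blast
    then show "{a, b} \<in> edges (total_graph (G\<lparr>edges := edges G - {?e}\<rparr>))"
      using ab unfolding P_def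
      by (cases a; cases b) (simp_all add: total_graph_edge_simps)
  qed
  ultimately have old: "degenerate_list ?T (k + 2) ?zs" by simp
  have fin: "finite {f \<in> edges G. w \<in> f}" for w using finite_edges[OF G] by simp
  \<comment> \<open>Earlier neighbours of the edge are \<open>v\<close> and the other edges at
    \<open>u\<close> and \<open>v\<close>; the vertex \<open>u\<close> comes later. This makes at
    most \<open>degree G u + degree G v - 1\<close>.\<close>
  have e_last: "card {z \<in> set ?zs. {z, Inr ?e} \<in> ?T} < k + 2"
  proof -
    let ?A = "\<lambda>w. {f \<in> edges G. w \<in> f} - {?e}"
    have "{z \<in> set ?zs. {z, Inr ?e} \<in> ?T} \<subseteq> insert (Inl v) (Inr ` (?A u \<union> ?A v))"
    proof
      fix z assume "z \<in> {z \<in> set ?zs. {z, Inr ?e} \<in> ?T}"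
      then show "z \<in> insert (Inl v) (Inr ` (?A u \<union> ?A v))"
        by (cases z) (auto simp: total_graph_edge_simps)
    qed
    then have "card {z \<in> set ?zs. {z, Inr ?e} \<in> ?T} \<le> card (insert (Inl v :: 'a + 'a set) (Inr ` (?A u \<union> ?A v)))"
      using fin by (intro card_mono) auto
    also have "\<dots> \<le> Suc (card (?A u \<union> ?A v))"
      using fin by (simp add: card_insert_if card_image)
    also have "\<dots> \<le> Suc (card (?A u) + card (?A v))" using card_Un_le by simp
    also have "\<dots> = Suc ((degree G u - 1) + (degree G v - 1))"
      using e fin by (simp add: degree_def card_Diff_singleton)
    also have "\<dots> < k + 2"
    proof -
      have "degree G u \<noteq> 0" "degree G v \<noteq> 0" using fin e by (auto simp: degree_def)
      then show ?thesis using light(2) by linarith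
    qed
    finally show ?thesis .
  qed
  \<comment> \<open>In the total graph \<open>u\<close> has at most \<open>degree G u\<close>
    adjacent vertices and exactly \<open>degree G u\<close> incident edges.\<close>
  have u_last: "card {z \<in> set (Inr ?e # ?zs). {z, Inl u} \<in> ?T} < k + 2"
  proof -
    let ?N = "{w. {u, w} \<in> edges G}" and ?S = "{f \<in> edges G. u \<in> f}"
    have "{z \<in> set (Inr ?e # ?zs). {z, Inl u} \<in> ?T} \<subseteq> Inl ` ?N \<union> Inr ` ?S"
    proof
      fix z assume "z \<in> {z \<in> set (Inr ?e # ?zs). {z, Inl u} \<in> ?T}"
      then show "z \<in> Inl ` ?N \<union> Inr ` ?S"
        by (cases z) (auto simp: total_graph_edge_simps insert_commute)
    qed
    then have "card {z \<in> set (Inr ?e # ?zs). {z, Inl u} \<in> ?T} \<le> card ((Inl ` ?N :: ('a + 'a set) set) \<union> Inr ` ?S)"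
      using fin card_neighbours_le(1)[OF G] by (intro card_mono) auto
    also have "\<dots> \<le> card (Inl ` ?N :: ('a + 'a set) set) + card (Inr ` ?S :: ('a + 'a set) set)"
      by (rule card_Un_le)
    also have "\<dots> \<le> 2 * degree G u"
      using card_neighbours_le(2)[OF G, of u] by (simp add: card_image degree_def)
    finally show ?thesis using light(1) by linarith
  qed
  have "Inr ?e \<notin> set ?zs" "Inl u \<notin> set (Inr ?e # ?zs)" using V by auto
  then have "degenerate_list ?T (k + 2) (Inl u # Inr ?e # ?zs)" using old e_last u_last by simp
  moreover have "set (Inl u # Inr ?e # ?zs) = verts (total_graph G)"
    using V uv(1) e by (auto simp: total_graph_def)
  ultimately show ?thesis by blast
qed

lemma has_cycle_if_is_cycle:
  assumes "finite_simple_graph G" "is_cycle F" "F \<subseteq> edges G"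
  shows "has_cycle_of_length G (card F)"
proof -
  obtain c where c: "distinct c" "3 \<le> length c" "F = path_edges (c @ [hd c])"
    using assms(2) unfolding is_cycle_def by blast
  have "\<Union>F = set c" unfolding c(3) using c(2) by (subst Union_path_edges) (auto intro!: hd_in_set)
  then have len: "length c = card F" using is_cycle_card(1)[OF assms(2)] distinct_card[OF c(1)] by simp
  have "{c ! i, c ! (Suc i mod card F)} \<in> edges G" if i: "i < card F" for i
  proof -
    let ?d = "c @ [hd c]"
    have "{?d ! i, ?d ! Suc i} \<in> F" unfolding c(3) path_edges_conv_nth using i len by auto
    moreover have "?d ! i = c ! i" using i len by (simp add: nth_append)
    \<comment> \<open>At the last index the appended \<open>hd c\<close> takes the place of the
      wrap-around modulo the length.\<close>
    moreover have "?d ! Suc i = c ! (Suc i mod card F)"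
    proof (cases "Suc i < card F")
      case True
      then show ?thesis using len by (simp add: nth_append)
    next
      case False
      then have "Suc i = card F" using i by simp
      moreover have "c \<noteq> []" using c(2) by auto
      ultimately show ?thesis using len by (simp add: nth_append hd_conv_nth)
    qed
    ultimately show ?thesis using assms(3) by auto
  qed
  moreover have "set c \<subseteq> verts G"
    using assms(1,3) \<open>\<Union>F = set c\<close> unfolding finite_simple_graph_def by blast
  ultimately show ?thesis unfolding has_cycle_of_length_def using c len by auto
qed

section \<open>End blocks and the existence of a light edge\<close>

lemma degree_le_max_degree:
  assumes "finite_simple_graph G" "v \<in> verts G"
  shows "degree G v \<le> max_degree G"
  using assms unfolding max_degree_def finite_simple_graph_def by (intro Max_ge) auto

text \<open>An end block is a minimal vertex set \<open>W\<close> that has at most one neighbour \<open>x\<close> outside, together with \<open>x\<close>.\<close>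

lemma nonseparable_end_block:
  assumes fin: "finite E" and c2: "\<And>e. e \<in> E \<Longrightarrow> card e = 2" and "E \<noteq> {}"
  obtains x W where "x \<notin> W" "W \<noteq> {}" "\<And>e. e \<in> E \<Longrightarrow> e \<inter> W \<noteq> {} \<Longrightarrow> e \<subseteq> insert x W"
    "\<Union>{e \<in> E. e \<subseteq> insert x W} = insert x W" "nonseparable {e \<in> E. e \<subseteq> insert x W}"
proof -
  have finV: "finite (\<Union>E)" using fin c2 by (metis card.infinite finite_Union zero_neq_numeral)
  define P where "P W x \<longleftrightarrow> W \<noteq> {} \<and> W \<subseteq> \<Union>E - {x} \<and> x \<in> \<Union>E \<and> (\<forall>e\<in>E. e \<inter> W \<noteq> {} \<longrightarrow> e \<subseteq> insert x W)" for W x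
  have pair: "\<exists>b. b \<noteq> a \<and> e = {a, b}" if ea: "e \<in> E" "a \<in> e" for a e
  proof -
    obtain p q where "e = {p, q}" "p \<noteq> q" using c2[OF ea(1)] by (auto simp: card_2_iff)
    then show ?thesis using ea(2) by auto
  qed
  obtain e where e: "e \<in> E" using assms(3) by blast
  then obtain a b where ab: "a \<noteq> b" "e = {a, b}" using c2[OF e] by (auto simp: card_2_iff)
  have "P (\<Union>E - {a}) a" unfolding P_def using e ab by auto
  then have ex: "\<exists>n W x. P W x \<and> card W = n" by blast
  define n where "n = (LEAST n. \<exists>W x. P W x \<and> card W = n)"
  obtain W x where Wx: "P W x" "card W = n" using LeastI_ex[OF ex] unfolding n_def by blast
  have min: "card W \<le> card W'" if "P W' y" for W' y
    unfolding Wx(2) n_def by (rule Least_le) (use that in blast)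
  have W: "W \<noteq> {}" "x \<notin> W" "W \<subseteq> \<Union>E" "x \<in> \<Union>E" and cl: "\<And>e. e \<in> E \<Longrightarrow> e \<inter> W \<noteq> {} \<Longrightarrow> e \<subseteq> insert x W"
    using Wx(1) unfolding P_def by blast+
  have finW: "finite W" using W(3) finV finite_subset by blast
  let ?H = "{e \<in> E. e \<subseteq> insert x W}"
  have WH: "W \<subseteq> \<Union>?H"
  proof
    fix w assume "w \<in> W"
    then obtain e where "e \<in> E" "w \<in> e" using W(3) by blast
    then show "w \<in> \<Union>?H" using cl[of e] \<open>w \<in> W\<close> by blast
  qed
  have xH: "x \<in> \<Union>?H"
  proof (rule ccontr)
    assume no: "x \<notin> \<Union>?H"
    obtain w where w: "w \<in> W" using W(1) by blast
    then obtain e where e: "e \<in> ?H" "w \<in> e" using WH by blast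
    then obtain w' where w': "w' \<noteq> w" "e = {w, w'}" using pair by blast
    have "w' \<in> W" using e w' no by blast
    \<comment> \<open>If \<open>x\<close> had no edge to \<open>W\<close>, then \<open>W\<close>
      without any of its vertices \<open>w\<close> would be a smaller candidate, with
      \<open>w\<close> as its outside neighbour.\<close>
    have "P (W - {w}) w"
      unfolding P_def
    proof (intro conjI ballI impI)
      show "W - {w} \<noteq> {}" using w'(1) \<open>w' \<in> W\<close> by blast
      show "W - {w} \<subseteq> \<Union>E - {w}" using W(3) by blast
      show "w \<in> \<Union>E" using w W(3) by blast
      fix f assume f: "f \<in> E" "f \<inter> (W - {w}) \<noteq> {}"
      then have "f \<in> ?H" using cl[of f] by blast
      then show "f \<subseteq> insert w (W - {w})" using no by blast
    qed
    then have "card W \<le> card (W - {w})" by (rule min)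
    then show False using card_Diff1_less[OF finW w] by simp
  qed
  have UH: "\<Union>?H = insert x W" using WH xH by blast
  have "nonseparable ?H"
    unfolding nonseparable_def
  proof (intro ballI allI impI)
    fix a U assume a: "a \<in> \<Union>?H" and U: "U \<noteq> {}" "U \<subseteq> \<Union>?H - {a}"
      and Ucl: "\<forall>e\<in>?H. e \<inter> U \<noteq> {} \<longrightarrow> e \<subseteq> insert a U"
    \<comment> \<open>Such a \<open>U1\<close> has at most the outside neighbour \<open>a\<close>,
      so minimality of \<open>W\<close> applies.\<close>
    have key: "U1 = W" if U1: "U1 \<noteq> {}" "U1 \<subseteq> W" "a \<notin> U1" "\<forall>e\<in>?H. e \<inter> U1 \<noteq> {} \<longrightarrow> e \<subseteq> insert a U1" for U1
    proof -
      have "P U1 a"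
        unfolding P_def
      proof (intro conjI ballI impI)
        show "U1 \<noteq> {}" using U1 by blast
        show "U1 \<subseteq> \<Union>E - {a}" using U1(2,3) W(3) by blast
        show "a \<in> \<Union>E" using a by blast
        fix f assume f: "f \<in> E" "f \<inter> U1 \<noteq> {}"
        then have "f \<inter> W \<noteq> {}" using U1(2) by blast
        then have "f \<in> ?H" using cl[OF f(1)] f(1) by simp
        then show "f \<subseteq> insert a U1" using U1(4) f(2) by blast
      qed
      then have "card W \<le> card U1" by (rule min)
      then show ?thesis using card_seteq[OF finW U1(2)] by simp
    qed
    show "U = \<Union>?H - {a}"
    proof (rule ccontr)
      assume neq: "U \<noteq> \<Union>?H - {a}"
      \<comment> \<open>Both \<open>U\<close> and \<open>U'\<close> have edges only to themselves
        and \<open>a\<close>. One of them avoids \<open>x\<close> and is therefore all of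
        \<open>W\<close>; the other is contained in \<open>{x}\<close>, which leaves no place for
        \<open>a\<close>.\<close>
      define U' where "U' = \<Union>?H - {a} - U"
      have U': "U' \<noteq> {}" "a \<notin> U'" "U' \<inter> U = {}" "U' \<subseteq> insert x W" using neq U UH unfolding U'_def by auto
      have U'cl: "\<forall>e\<in>?H. e \<inter> U' \<noteq> {} \<longrightarrow> e \<subseteq> insert a U'"
      proof (intro ballI impI)
        fix f assume f: "f \<in> ?H" "f \<inter> U' \<noteq> {}"
        have "f \<inter> U = {}"
        proof (rule ccontr)
          assume "f \<inter> U \<noteq> {}"
          then have "f \<subseteq> insert a U" using Ucl f(1) by blast
          then show False using f(2) U'(2,3) by blast
        qed
        then show "f \<subseteq> insert a U'" using f(1) unfolding U'_def by blast
      qed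
      have Usub: "U \<subseteq> insert x W" "a \<notin> U" using U(2) UH by auto
      show False
      proof (cases "x \<in> U")
        case True
        then have "U' \<subseteq> W" using U'(3,4) by blast
        then have eq: "U' = W" using key U' U'cl by blast
        then have "U \<subseteq> {x}" using Usub(1) U'(3) by blast
        then have "a \<in> W" using Usub(2) True a UH by blast
        then show False using eq U'(2) by blast
      next
        case False
        then have "U \<subseteq> W" using Usub(1) by blast
        then have eq: "U = W" using key[OF U(1) _ Usub(2) Ucl] by blast
        then have "U' \<subseteq> {x}" using U'(3,4) by blast
        then have "x \<noteq> a" using U'(1,2) by blast
        then have "a \<in> W" using a UH by blast
        then show False using eq Usub(2) by blast
      qed
    qed
  qed
  then show thesis using that[OF W(2,1) cl UH] by blast
qed

lemma plane_graph_if_plane_drawing: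
  assumes G: "finite_simple_graph G" and dr: "plane_drawing G p \<gamma>" and H: "H \<subseteq> edges G"
  shows "plane_graph H p \<gamma>"
proof -
  have inj: "inj_on p (verts G)"
    and edge: "\<And>e. e \<in> edges G \<Longrightarrow> arc (\<gamma> e) \<and> {pathstart (\<gamma> e), pathfinish (\<gamma> e)} = p ` e \<and>
        path_image (\<gamma> e) \<inter> p ` verts G = p ` e"
    and cross: "\<And>e f. e \<in> edges G \<Longrightarrow> f \<in> edges G \<Longrightarrow> e \<noteq> f \<Longrightarrow>
        path_image (\<gamma> e) \<inter> path_image (\<gamma> f) \<subseteq> p ` (e \<inter> f)"
    using dr unfolding plane_drawing_def by simp_all
  have sub: "\<Union>H \<subseteq> verts G" using G H unfolding finite_simple_graph_def by blast
  show ?thesis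
  proof
    show "finite H" using finite_edges[OF G] H finite_subset by blast
    show "card e = 2" if "e \<in> H" for e using that G H unfolding finite_simple_graph_def by blast
    show "inj_on p (\<Union>H)" using inj sub by (rule inj_on_subset)
    show "arc (\<gamma> e)" "{pathstart (\<gamma> e), pathfinish (\<gamma> e)} = p ` e" if "e \<in> H" for e
      using edge[of e] that H by auto
    show "path_image (\<gamma> e) \<inter> path_image (\<gamma> f) \<subseteq> p ` (e \<inter> f)" if "e \<in> H" "f \<in> H" "e \<noteq> f" for e f
      using that H by (intro cross) auto
    show "path_image (\<gamma> e) \<inter> p ` \<Union>H = p ` e" if "e \<in> H" for e
    proof -
      have "path_image (\<gamma> e) \<inter> p ` verts G = p ` e" using edge[of e] that H by auto
      moreover have "p ` e \<subseteq> p ` \<Union>H" using that by (intro image_mono) blast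
      moreover have "p ` \<Union>H \<subseteq> p ` verts G" using sub by (rule image_mono)
      ultimately show ?thesis by (metis Int_absorb1 Int_absorb2 Int_assoc)
    qed
  qed
qed

text \<open>Without light edges an end block would satisfy all assumptions of
  \<open>discharging\<close>. Vertices of the block other than \<open>x\<close> have all their edges
  inside it, so their degrees in \<open>H\<close> and \<open>G\<close> agree.\<close>

lemma light_edge:
  assumes "7 \<le> k" and G: "finite_simple_graph G" and pl: "planar G" and "max_degree G \<le> k"
    and no5: "\<not> has_cycle_of_length G 5" and no6: "\<not> has_cycle_of_length G 6" and ne: "edges G \<noteq> {}"
  shows "\<exists>u v. {u, v} \<in> edges G \<and> 2 * degree G u \<le> k + 1 \<and> degree G u + degree G v \<le> k + 2"
proof (rule ccontr)
  assume "\<not> ?thesis"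
  then have heavy: "k + 2 < degree G u + degree G v" if "{u, v} \<in> edges G" "2 * degree G u \<le> k + 1" for u v
    using that by (meson not_le)
  have card2: "card e = 2" if "e \<in> edges G" for e using that G unfolding finite_simple_graph_def by blast
  have sub: "\<Union>(edges G) \<subseteq> verts G" using G unfolding finite_simple_graph_def by blast
  have deg_le: "degree G v \<le> k" if "v \<in> \<Union>(edges G)" for v
    using degree_le_max_degree[OF G] sub that assms(4) le_trans by blast
  \<comment> \<open>A vertex of degree at most 2 would make any of its edges light, as the other end
    has degree at most \<open>k\<close>.\<close>
  have deg3: "3 \<le> degree G v" if v: "v \<in> \<Union>(edges G)" for v
  proof (rule ccontr)
    assume "\<not> 3 \<le> degree G v"
    then have d: "degree G v \<le> 2" by simp
    obtain e where e: "e \<in> edges G" "v \<in> e" using v by blast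
    then obtain u where u: "e = {v, u}" using card2[OF e(1)] by (auto simp: card_2_iff)
    then have "u \<in> \<Union>(edges G)" using e by blast
    then show False using deg_le[of u] heavy[of v u] e(1) u d assms(1) by simp
  qed
  obtain x W where W: "x \<notin> W" "W \<noteq> {}" "\<And>e. e \<in> edges G \<Longrightarrow> e \<inter> W \<noteq> {} \<Longrightarrow> e \<subseteq> insert x W"
    "\<Union>{e \<in> edges G. e \<subseteq> insert x W} = insert x W" "nonseparable {e \<in> edges G. e \<subseteq> insert x W}"
    using nonseparable_end_block[OF finite_edges[OF G] card2 ne] by blast
  define H where "H = {e \<in> edges G. e \<subseteq> insert x W}"
  have HG: "H \<subseteq> edges G" and UH: "\<Union>H = insert x W" and nsH: "nonseparable H"
    using W(4,5) by (auto simp: H_def)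
  have star: "{e \<in> H. w \<in> e} = {e \<in> edges G. w \<in> e}" if "w \<in> W" for w
    using W(3) that unfolding H_def by blast
  then have degH: "card {e \<in> H. w \<in> e} = degree G w" if "w \<in> W" for w using that by (simp add: degree_def)
  obtain p \<gamma> where "plane_drawing G p \<gamma>" using pl unfolding planar_def by blast
  then interpret plane_graph H p \<gamma> by (rule plane_graph_if_plane_drawing[OF G _ HG])
  obtain w where w: "w \<in> W" using W(2) by blast
  then have "w \<in> \<Union>(edges G)" using UH HG by blast
  then have "2 \<le> card {e \<in> H. w \<in> e}" using deg3[of w] degH[OF w] by simp
  then obtain e f where ef: "e \<in> H" "f \<in> H" "w \<in> e" "w \<in> f" "e \<noteq> f"
    by (metis (no_types, lifting) card_2_iff' card_le_Suc0_iff_eq card.infinite mem_Collect_eq not_less_eq_eq numeral_2_eq_2 zero_le)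
  obtain y where y: "e = {w, y}" using card_edge[OF ef(1)] ef(3) by (auto simp: card_2_iff)
  obtain z where z: "f = {w, z}" using card_edge[OF ef(2)] ef(4) by (auto simp: card_2_iff)
  obtain \<Phi> where "face_family H \<Phi>"
    using face_family_exists[OF nsH, of w y z] ef y z by auto
  note D = face_familyD[OF this]
  interpret discharging H \<Phi> fst x
  proof
    show "finite \<Phi>" "card H + 2 = card \<Phi> + card (\<Union>H)" using D by auto
    show "is_cycle (fst \<phi>)" "fst \<phi> \<subseteq> H" if "\<phi> \<in> \<Phi>" for \<phi>
      using D(4,5)[of "fst \<phi>" "snd \<phi>"] that by auto
    show "card F \<noteq> 5 \<and> card F \<noteq> 6" if "is_cycle F" "F \<subseteq> H" for F
      using has_cycle_if_is_cycle[OF G that(1)] that(2) HG no5 no6 by (metis subset_trans)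
    show "x \<in> \<Union>H" using UH by simp
    show "3 \<le> card {e \<in> H. v \<in> e}" if "v \<in> \<Union>H" "v \<noteq> x" for v
      using that UH HG degH[of v] deg3[of v] by auto
    fix u v assume uv: "{u, v} \<in> H" "v \<noteq> x" "u \<noteq> x"
    then have W: "u \<in> W" "v \<in> W" using UH by auto
    \<comment> \<open>Since \<open>k \<ge> 7\<close>, degree 3 or 4 of \<open>v\<close> satisfies
      the bound \<open>k + 1\<close> in \<open>heavy\<close>. So the degree of \<open>u\<close>
      exceeds \<open>k - 1\<close> or \<open>k - 2\<close>, respectively.\<close>
    have "{v, u} \<in> edges G" using uv HG by (auto simp: insert_commute)
    note h = heavy[OF this]
    show "7 \<le> card {e \<in> H. u \<in> e}" if "card {e \<in> H. v \<in> e} = 3"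
      using h that degH[OF W(1)] degH[OF W(2)] assms(1) by simp
    show "6 \<le> card {e \<in> H. u \<in> e}" if "card {e \<in> H. v \<in> e} = 4"
      using h that degH[OF W(1)] degH[OF W(2)] assms(1) by simp
  qed (use D(10,11) finite_E card_edge in auto)
  show False by (rule discharging_False)
qed

section \<open>Induction on the number of edges\<close>

lemma degree_delete_le:
  assumes "finite_simple_graph G"
  shows "degree (G\<lparr>edges := edges G - A\<rparr>) v \<le> degree G v"
  unfolding degree_def using finite_edges[OF assms] by (intro card_mono) auto

text \<open>All hypotheses survive the deletion of a light edge: the drawing restricts, degrees do
  not grow and no cycles arise. Without edges the total graph has none either, and any ordering
  works.\<close>

lemma total_graph_degenerate:
  assumes "7 \<le> k" "finite_simple_graph G" "planar G" "max_degree G \<le> k"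
    "\<not> has_cycle_of_length G 5" "\<not> has_cycle_of_length G 6"
  shows "\<exists>ys. degenerate_list (edges (total_graph G)) (k + 2) ys \<and> set ys = verts (total_graph G)"
  using assms
proof (induction "card (edges G)" arbitrary: G rule: less_induct)
  case less
  note G = less.prems(2)
  show ?case
  proof (cases "edges G = {}")
    case True
    then have "edges (total_graph G) = {}" by (simp add: total_graph_def)
    moreover have "finite (verts (total_graph G))"
      using finite_simple_graph_total_graph[OF G] by (simp add: finite_simple_graph_def)
    then obtain ys where "set ys = verts (total_graph G)" "distinct ys"
      using finite_distinct_list by blast
    ultimately show ?thesis using degenerate_list_empty by (metis add_gr_0 zero_less_numeral)
  next
    case False
    obtain u v where uv: "{u, v} \<in> edges G" "2 * degree G u \<le> k + 1" "degree G u + degree G v \<le> k + 2"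
      using light_edge[OF less.prems False] by blast
    let ?G = "G\<lparr>edges := edges G - {{u, v}}\<rparr>"
    have "card (edges ?G) < card (edges G)"
      using card_Diff1_less[OF finite_edges[OF G] uv(1)] by simp
    moreover have "finite_simple_graph ?G" using G unfolding finite_simple_graph_def by simp
    moreover have "planar ?G"
    proof -
      obtain p \<gamma> where "plane_drawing G p \<gamma>" using less.prems(3) unfolding planar_def by blast
      then have "plane_drawing ?G p \<gamma>" unfolding plane_drawing_def by simp
      then show ?thesis unfolding planar_def by blast
    qed
    moreover have "max_degree ?G \<le> k"
    proof -
      have "degree ?G w \<le> k" if "w \<in> verts G" for w
        using degree_delete_le[OF G] degree_le_max_degree[OF G that] less.prems(4) le_trans by blast
      moreover have "finite (verts G)" using G by (simp add: finite_simple_graph_def)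
      ultimately show ?thesis unfolding max_degree_def by auto
    qed
    moreover have "has_cycle_of_length ?G n \<Longrightarrow> has_cycle_of_length G n" for n
      unfolding has_cycle_of_length_def by auto
    then have "\<not> has_cycle_of_length ?G 5" "\<not> has_cycle_of_length ?G 6" using less.prems(5,6) by blast+
    ultimately obtain ys where "degenerate_list (edges (total_graph ?G)) (k + 2) ys" "set ys = verts (total_graph ?G)"
      using less.hyps[of ?G] less.prems(1) by blast
    then show ?thesis by (rule degenerate_list_add_light_edge[OF G uv])
  qed
qed

theorem theorem10:
  fixes G :: "'a sgraph" and k :: nat
  assumes "7 \<le> k"
    and "finite_simple_graph G"
    and "planar G"
    and "max_degree G \<le> k"
    and "\<not> has_cycle_of_length G 5"
    and "\<not> has_cycle_of_length G 6"
  shows "coloring_number (total_graph G) \<le> k + 2"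
  using total_graph_degenerate[OF assms] coloring_number_le by blast

end
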